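(* Let $(V,\|\cdot\|)$ be a normed space and let $T$ be a continuous $t$-norm. Let $f:[0,+\infty)\to[0,1]$ be a right-continuous nonincreasing function satisfying the following two properties: (a) $f(x)=1$ if and only if $x=0$; (b) $f(\|p+q\|)\ge T\left(f(\|p\|),f(\|q\|)\right)$ for every $p,q\in V$. Let $\nu:V\to\Delta^+$ be given, for every $p\in V$, by $\nu_p(x)=0$ for $x\le 0$, $\nu_p(x)=f(\|p\|)$ for $x\in(0,+\infty)$, and $\nu_p(+\infty)=1$. Then $(V,\nu,\tau_T,\tau_{T^*})$ is a Menger PN space satisfying the following properties: (F1) $(V,\nu,\tau_T,\tau_{T^*})$ is a topological vector space in the strong topology; (F2) $(V,\nu,\tau_T,\tau_{T^*})$ is normable; (F3) if $p\in V$ and $t>0$, then the strong neighbourhood $N_p(t)$ in $(V,\nu,\tau_T,\tau_{T^*})$ is not $\mathcal{D}$-bounded, but $N_p(t)$ is topologically bounded whenever $N_p(t)\neq V$; (F4) $(V,\nu,\tau_T,\tau_{T^*})$ is not a Šerstnev space; (F5) $(V,\nu,\tau_T,\tau_{T^*})$ is not a characteristic PN space.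
   Context: Vector spaces are real; $\theta$ is the null vector of $V$. $\Delta^+$ is the set of distance distribution functions: functions $F:[-\infty,+\infty]\to[0,1]$ that are nondecreasing, left-continuous on $\mathbf{R}$, with $F(-\infty)=0$, $F(0)=0$, $F(+\infty)=1$. $\mathcal{D}^+$ is the set of $F\in\Delta^+$ with $\lim_{x\to+\infty}F(x)=1$. $\Delta^+$ carries the pointwise order and the (metrizable) topology of weak convergence. $\varepsilon_0\in\Delta^+$ is given by $\varepsilon_0(t)=0$ for $t\le 0$ and $\varepsilon_0(t)=1$ for $t>0$. A triangle function is a map $\tau:\Delta^+\times\Delta^+\to\Delta^+$ that is commutative, associative, nondecreasing in each variable and has $\varepsilon_0$ as identity. A Probabilistic Normed (PN) space is a quadruple $(V,\nu,\tau,\tau^* )$ where $V$ is a vector space, $\tau,\tau^*$ are continuous triangle functions with $\tau\le\tau^*$, and $\nu:V\to\Delta^+$, $p\mapsto\nu_p$, satisfies, for all $p,q\in V$: (N1) $\nu_p=\varepsilon_0$ iff $p=\theta$; (N2) $\nu_{-p}=\nu_p$; (N3) $\nu_{p+q}\ge\tau(\nu_p,\nu_q)$; (N4) $\nu_p\le\tau^*(\nu_{\lambda p},\nu_{(1-\lambda)p})$ for every $\lambda\in[0,1]$. A $t$-norm is a map $T:[0,1]^2\to[0,1]$ that is commutative, associative, nondecreasing in each variable and has $1$ as identity. Given a continuous $t$-norm $T$, put $T^*(x,y)=1-T(1-x,1-y)$ and, for real $x$, $\tau_T(F,G)(x)=\sup_{s+t=x}T(F(s),G(t))$, $\tau_{T^*}(F,G)(x)=\inf_{s+t=x}T^*(F(s),G(t))$.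 A Menger PN space is a PN space of the form $(V,\nu,\tau_T,\tau_{T^*})$ with $T$ a continuous $t$-norm. A PN space is a Šerstnev space if it satisfies (N1), (N3) and: $\nu_{\alpha p}(x)=\nu_p(x/|\alpha|)$ for all $p\in V$, $\alpha\in\mathbf{R}\setminus\{0\}$, $x>0$. A PN space is characteristic if $\nu_p\in\mathcal{D}^+$ for every $p\in V$. The strong topology on $V$ is the topology generated by the strong neighbourhoods $N_p(t)=\{q\in V:\nu_{p-q}(t)>1-t\}$, $p\in V$, $t>0$ (these form a neighbourhood base at $p$). The PN space is normable if there is a norm on $V$ that generates the strong topology. A subset $A\subseteq V$ is $\mathcal{D}$-bounded if there is $G\in\mathcal{D}^+$ with $\nu_p\ge G$ for every $p\in A$. A subset $A$ of a topological vector space is topologically bounded if for every sequence $(\alpha_n)$ of real numbers converging to $0$ and every sequence $(p_n)$ of elements of $A$ one has $\alpha_n p_n\to\theta$.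
   Formalization: The formal theorem assumes that V is not the zero space; for V = {θ} the claims (F3), (F4) and (F5) fail, since ν_θ = ε_0 lies in D⁺ and N_θ(t) = {θ} is D-bounded. *)

theory Defs
  imports "HOL-Analysis.Analysis" "HOL-Probability.Weak_Convergence"
begin

definition Delta_plus :: "(ereal \<Rightarrow> real) set" where
  "Delta_plus = {F. (\<forall>x. F x \<in> {0..1}) \<and> mono F
      \<and> (\<forall>x::real. continuous (at_left x) (\<lambda>y. F (ereal y)))
      \<and> F (-\<infinity>) = 0 \<and> F 0 = 0 \<and> F \<infinity> = 1}"

definition D_plus :: "(ereal \<Rightarrow> real) set" where
  "D_plus = {F \<in> Delta_plus. ((\<lambda>x::real. F (ereal x)) \<longlongrightarrow> 1) at_top}"

definition eps0 :: "ereal \<Rightarrow> real" where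
  "eps0 t = (if t \<le> 0 then 0 else 1)"

definition weak_conv_ddf :: "(nat \<Rightarrow> ereal \<Rightarrow> real) \<Rightarrow> (ereal \<Rightarrow> real) \<Rightarrow> bool" where
  "weak_conv_ddf X F \<longleftrightarrow> weak_conv (\<lambda>n x. X n (ereal x)) (\<lambda>x. F (ereal x))"

(* The topology of weak convergence is metrizable, hence determined by its convergent
   sequences: a set is open iff every sequence converging weakly to one of its points is
   eventually in it. That its convergent sequences are exactly the weakly convergent ones
   is limitin_weak_topology_iff below. *)
definition weak_topology :: "(ereal \<Rightarrow> real) topology" where
  "weak_topology = topology (\<lambda>U. U \<subseteq> Delta_plus \<and>
     (\<forall>X F. (\<forall>n. X n \<in> Delta_plus) \<and> F \<in> U \<and> weak_conv_ddf X F
        \<longrightarrow> (\<forall>\<^sub>F n in sequentially. X n \<in> U)))"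

definition triangle_function ::
  "((ereal \<Rightarrow> real) \<Rightarrow> (ereal \<Rightarrow> real) \<Rightarrow> ereal \<Rightarrow> real) \<Rightarrow> bool" where
  "triangle_function \<tau> \<longleftrightarrow>
     (\<forall>F\<in>Delta_plus. \<forall>G\<in>Delta_plus. \<tau> F G \<in> Delta_plus)
   \<and> (\<forall>F\<in>Delta_plus. \<forall>G\<in>Delta_plus. \<tau> F G = \<tau> G F)
   \<and> (\<forall>F\<in>Delta_plus. \<forall>G\<in>Delta_plus. \<forall>H\<in>Delta_plus. \<tau> (\<tau> F G) H = \<tau> F (\<tau> G H))
   \<and> (\<forall>F\<in>Delta_plus. \<forall>F'\<in>Delta_plus. \<forall>G\<in>Delta_plus. \<forall>G'\<in>Delta_plus.
        F \<le> F' \<and> G \<le> G' \<longrightarrow> \<tau> F G \<le> \<tau> F' G')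
   \<and> (\<forall>F\<in>Delta_plus. \<tau> F eps0 = F)"

definition continuous_triangle_function ::
  "((ereal \<Rightarrow> real) \<Rightarrow> (ereal \<Rightarrow> real) \<Rightarrow> ereal \<Rightarrow> real) \<Rightarrow> bool" where
  "continuous_triangle_function \<tau> \<longleftrightarrow> triangle_function \<tau> \<and>
     continuous_map (prod_topology weak_topology weak_topology) weak_topology (\<lambda>(F, G). \<tau> F G)"

definition PN1 :: "('v::real_vector \<Rightarrow> ereal \<Rightarrow> real) \<Rightarrow> bool" where
  "PN1 \<nu> \<longleftrightarrow> (\<forall>p. \<nu> p = eps0 \<longleftrightarrow> p = 0)"

definition PN2 :: "('v::real_vector \<Rightarrow> ereal \<Rightarrow> real) \<Rightarrow> bool" where
  "PN2 \<nu> \<longleftrightarrow> (\<forall>p. \<nu> (- p) = \<nu> p)"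

definition PN3 :: "('v::real_vector \<Rightarrow> ereal \<Rightarrow> real) \<Rightarrow>
    ((ereal \<Rightarrow> real) \<Rightarrow> (ereal \<Rightarrow> real) \<Rightarrow> ereal \<Rightarrow> real) \<Rightarrow> bool" where
  "PN3 \<nu> \<tau> \<longleftrightarrow> (\<forall>p q. \<nu> (p + q) \<ge> \<tau> (\<nu> p) (\<nu> q))"

definition PN4 :: "('v::real_vector \<Rightarrow> ereal \<Rightarrow> real) \<Rightarrow>
    ((ereal \<Rightarrow> real) \<Rightarrow> (ereal \<Rightarrow> real) \<Rightarrow> ereal \<Rightarrow> real) \<Rightarrow> bool" where
  "PN4 \<nu> \<tau>' \<longleftrightarrow>
     (\<forall>p. \<forall>l\<in>{0..1::real}. \<nu> p \<le> \<tau>' (\<nu> (l *\<^sub>R p)) (\<nu> ((1 - l) *\<^sub>R p)))"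

(* The vector space V is the whole type 'v. *)
definition pn_space :: "('v::real_vector \<Rightarrow> ereal \<Rightarrow> real) \<Rightarrow>
    ((ereal \<Rightarrow> real) \<Rightarrow> (ereal \<Rightarrow> real) \<Rightarrow> ereal \<Rightarrow> real) \<Rightarrow>
    ((ereal \<Rightarrow> real) \<Rightarrow> (ereal \<Rightarrow> real) \<Rightarrow> ereal \<Rightarrow> real) \<Rightarrow> bool" where
  "pn_space \<nu> \<tau> \<tau>' \<longleftrightarrow>
     continuous_triangle_function \<tau> \<and> continuous_triangle_function \<tau>'
   \<and> (\<forall>F\<in>Delta_plus. \<forall>G\<in>Delta_plus. \<tau> F G \<le> \<tau>' F G)
   \<and> (\<forall>p. \<nu> p \<in> Delta_plus)
   \<and> PN1 \<nu> \<and> PN2 \<nu> \<and> PN3 \<nu> \<tau> \<and> PN4 \<nu> \<tau>'"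

definition tnorm :: "(real \<Rightarrow> real \<Rightarrow> real) \<Rightarrow> bool" where
  "tnorm T \<longleftrightarrow>
     (\<forall>x\<in>{0..1}. \<forall>y\<in>{0..1}. T x y \<in> {0..1})
   \<and> (\<forall>x\<in>{0..1}. \<forall>y\<in>{0..1}. T x y = T y x)
   \<and> (\<forall>x\<in>{0..1}. \<forall>y\<in>{0..1}. \<forall>z\<in>{0..1}. T (T x y) z = T x (T y z))
   \<and> (\<forall>x\<in>{0..1}. \<forall>x'\<in>{0..1}. \<forall>y\<in>{0..1}. \<forall>y'\<in>{0..1}.
        x \<le> x' \<and> y \<le> y' \<longrightarrow> T x y \<le> T x' y')
   \<and> (\<forall>x\<in>{0..1}. T x 1 = x)"

definition continuous_tnorm :: "(real \<Rightarrow> real \<Rightarrow> real) \<Rightarrow> bool" where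
  "continuous_tnorm T \<longleftrightarrow> tnorm T \<and> continuous_on ({0..1} \<times> {0..1}) (\<lambda>(x, y). T x y)"

definition dual_conorm :: "(real \<Rightarrow> real \<Rightarrow> real) \<Rightarrow> real \<Rightarrow> real \<Rightarrow> real" where
  "dual_conorm T x y = 1 - T (1 - x) (1 - y)"

(* The sup and inf formulas are prescribed at real arguments only; the values at the
   infinite arguments are those common to all elements of Delta_plus. *)
definition tau_sup :: "(real \<Rightarrow> real \<Rightarrow> real) \<Rightarrow>
    (ereal \<Rightarrow> real) \<Rightarrow> (ereal \<Rightarrow> real) \<Rightarrow> ereal \<Rightarrow> real" where
  "tau_sup T F G x = (if x = \<infinity> then 1 else if x = -\<infinity> then 0
     else Sup {T (F (ereal s)) (G (ereal t)) | s t :: real. ereal (s + t) = x})"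

definition tau_inf :: "(real \<Rightarrow> real \<Rightarrow> real) \<Rightarrow>
    (ereal \<Rightarrow> real) \<Rightarrow> (ereal \<Rightarrow> real) \<Rightarrow> ereal \<Rightarrow> real" where
  "tau_inf S F G x = (if x = \<infinity> then 1 else if x = -\<infinity> then 0
     else Inf {S (F (ereal s)) (G (ereal t)) | s t :: real. ereal (s + t) = x})"

definition menger_pn_space :: "('v::real_vector \<Rightarrow> ereal \<Rightarrow> real) \<Rightarrow>
    ((ereal \<Rightarrow> real) \<Rightarrow> (ereal \<Rightarrow> real) \<Rightarrow> ereal \<Rightarrow> real) \<Rightarrow>
    ((ereal \<Rightarrow> real) \<Rightarrow> (ereal \<Rightarrow> real) \<Rightarrow> ereal \<Rightarrow> real) \<Rightarrow> bool" where
  "menger_pn_space \<nu> \<tau> \<tau>' \<longleftrightarrow> pn_space \<nu> \<tau> \<tau>' \<and>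
     (\<exists>T. continuous_tnorm T \<and>
        (\<forall>F\<in>Delta_plus. \<forall>G\<in>Delta_plus.
           \<tau> F G = tau_sup T F G \<and> \<tau>' F G = tau_inf (dual_conorm T) F G))"

definition serstnev_space :: "('v::real_vector \<Rightarrow> ereal \<Rightarrow> real) \<Rightarrow>
    ((ereal \<Rightarrow> real) \<Rightarrow> (ereal \<Rightarrow> real) \<Rightarrow> ereal \<Rightarrow> real) \<Rightarrow> bool" where
  "serstnev_space \<nu> \<tau> \<longleftrightarrow> PN1 \<nu> \<and> PN3 \<nu> \<tau> \<and>
     (\<forall>p. \<forall>\<alpha>::real. \<forall>x::real. \<alpha> \<noteq> 0 \<and> x > 0 \<longrightarrow>
        \<nu> (\<alpha> *\<^sub>R p) (ereal x) = \<nu> p (ereal (x / \<bar>\<alpha>\<bar>)))"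

definition characteristic_pn :: "('v::real_vector \<Rightarrow> ereal \<Rightarrow> real) \<Rightarrow> bool" where
  "characteristic_pn \<nu> \<longleftrightarrow> (\<forall>p. \<nu> p \<in> D_plus)"

definition strong_nbhd :: "('v::real_vector \<Rightarrow> ereal \<Rightarrow> real) \<Rightarrow> 'v \<Rightarrow> real \<Rightarrow> 'v set" where
  "strong_nbhd \<nu> p t = {q. \<nu> (p - q) (ereal t) > 1 - t}"

definition strong_topology :: "('v::real_vector \<Rightarrow> ereal \<Rightarrow> real) \<Rightarrow> 'v topology" where
  "strong_topology \<nu> = topology_generated_by {strong_nbhd \<nu> p t | p t. t > 0}"

definition is_tvs :: "'v::real_vector topology \<Rightarrow> bool" where
  "is_tvs X \<longleftrightarrow> topspace X = UNIV
   \<and> continuous_map (prod_topology X X) X (\<lambda>(p, q). p + q)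
   \<and> continuous_map (prod_topology euclideanreal X) X (\<lambda>(a, p). a *\<^sub>R p)"

definition is_norm :: "('v::real_vector \<Rightarrow> real) \<Rightarrow> bool" where
  "is_norm N \<longleftrightarrow> (\<forall>p. N p \<ge> 0) \<and> (\<forall>p. N p = 0 \<longleftrightarrow> p = 0)
   \<and> (\<forall>p q. N (p + q) \<le> N p + N q) \<and> (\<forall>a p. N (a *\<^sub>R p) = \<bar>a\<bar> * N p)"

definition normable :: "('v::real_vector \<Rightarrow> ereal \<Rightarrow> real) \<Rightarrow> bool" where
  "normable \<nu> \<longleftrightarrow>
     (\<exists>N. is_norm N \<and> strong_topology \<nu> = Metric_space.mtopology UNIV (\<lambda>p q. N (p - q)))"

definition D_bounded :: "('v::real_vector \<Rightarrow> ereal \<Rightarrow> real) \<Rightarrow> 'v set \<Rightarrow> bool" where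
  "D_bounded \<nu> A \<longleftrightarrow> (\<exists>G\<in>D_plus. \<forall>p\<in>A. \<nu> p \<ge> G)"

definition topologically_bounded :: "'v::real_vector topology \<Rightarrow> 'v set \<Rightarrow> bool" where
  "topologically_bounded X A \<longleftrightarrow>
     (\<forall>(\<alpha>::nat \<Rightarrow> real) (p::nat \<Rightarrow> 'v). \<alpha> \<longlonglongrightarrow> 0 \<and> (\<forall>n. p n \<in> A)
        \<longrightarrow> limitin X (\<lambda>n. \<alpha> n *\<^sub>R p n) 0 sequentially)"

lemma openin_weak_topology:
  "openin weak_topology U \<longleftrightarrow> U \<subseteq> Delta_plus \<and>
     (\<forall>X F. (\<forall>n. X n \<in> Delta_plus) \<and> F \<in> U \<and> weak_conv_ddf X F
        \<longrightarrow> (\<forall>\<^sub>F n in sequentially. X n \<in> U))"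
proof -
  define P where "P U \<longleftrightarrow> U \<subseteq> Delta_plus \<and>
     (\<forall>X F. (\<forall>n. X n \<in> Delta_plus) \<and> F \<in> U \<and> weak_conv_ddf X F
        \<longrightarrow> (\<forall>\<^sub>F n in sequentially. X n \<in> U))" for U
  have "P (S \<inter> T)" if "P S" "P T" for S T
    using that unfolding P_def eventually_conj_iff Int_iff by blast
  moreover have "P (\<Union>K)" if K: "\<forall>S\<in>K. P S" for K
    unfolding P_def
  proof (intro conjI allI impI)
    show "\<Union>K \<subseteq> Delta_plus" using K by (auto simp: P_def)
    fix X F assume *: "(\<forall>n. X n \<in> Delta_plus) \<and> F \<in> \<Union>K \<and> weak_conv_ddf X F"
    then obtain S where S: "S \<in> K" "F \<in> S" by auto
    with K * have "\<forall>\<^sub>F n in sequentially. X n \<in> S" unfolding P_def by blast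
    then show "\<forall>\<^sub>F n in sequentially. X n \<in> \<Union>K"
      by (rule eventually_mono) (use S in auto)
  qed
  ultimately have "istopology P" unfolding istopology_def by auto
  then have "openin (topology P) U = P U" by (simp add: topology_inverse')
  moreover have "weak_topology = topology P"
    unfolding weak_topology_def P_def ..
  ultimately show ?thesis by (simp add: P_def)
qed

lemma topspace_weak_topology [simp]: "topspace weak_topology = Delta_plus"
proof -
  have "openin weak_topology Delta_plus"
    by (auto simp: openin_weak_topology)
  then show ?thesis
    using openin_topspace[of weak_topology] openin_subset
    by (metis openin_weak_topology subset_antisym)
qed

lemma Delta_plus_mono: "F \<in> Delta_plus \<Longrightarrow> x \<le> y \<Longrightarrow> F x \<le> F y"
  by (auto simp: Delta_plus_def mono_def)

lemma Delta_plus_isCont_between: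
  fixes a b :: real
  assumes F: "F \<in> Delta_plus" and ab: "a < b"
  obtains z where "a < z" "z < b" "isCont (\<lambda>x. F (ereal x)) z"
proof -
  have "mono (\<lambda>x. F (ereal x))"
    by (intro monoI Delta_plus_mono[OF F]) simp
  then have "countable {z. \<not> isCont (\<lambda>x. F (ereal x)) z}"
    by (rule mono_ctble_discont)
  moreover have "uncountable {a<..<b}"
    using ab by (simp add: uncountable_open_interval)
  ultimately have "\<not> {a<..<b} \<subseteq> {z. \<not> isCont (\<lambda>x. F (ereal x)) z}"
    using countable_subset by blast
  then show ?thesis using that by auto
qed

lemma limitin_weak_topology_iff:
  assumes X: "\<And>n. X n \<in> Delta_plus" and F: "F \<in> Delta_plus"
  shows "limitin weak_topology X F sequentially \<longleftrightarrow> weak_conv_ddf X F"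
proof
  assume "weak_conv_ddf X F"
  then show "limitin weak_topology X F sequentially"
    using X F unfolding limitin_def by (auto simp: openin_weak_topology)
next
  assume L: "limitin weak_topology X F sequentially"
  show "weak_conv_ddf X F"
    unfolding weak_conv_ddf_def weak_conv_def
  proof (intro allI impI, rule order_tendstoI)
    fix x a :: real assume a: "a < F (ereal x)"
    let ?U = "{H \<in> Delta_plus. a < H (ereal x)}"
    have "openin weak_topology ?U"
      unfolding openin_weak_topology
    proof (intro conjI allI impI)
      fix Y H assume *: "(\<forall>n. Y n \<in> Delta_plus) \<and> H \<in> ?U \<and> weak_conv_ddf Y H"
      then have "((\<lambda>y. H (ereal y)) \<longlongrightarrow> H (ereal x)) (at_left x)"
        by (auto simp: Delta_plus_def continuous_within)
      then have "\<forall>\<^sub>F y in at_left x. a < H (ereal y)"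
        using * by (auto intro: order_tendstoD)
      then obtain y where y: "y < x" "\<And>z. y < z \<Longrightarrow> z < x \<Longrightarrow> a < H (ereal z)"
        by (auto simp: eventually_at_left_field)
      obtain z where z: "y < z" "z < x" "isCont (\<lambda>x. H (ereal x)) z"
        using Delta_plus_isCont_between[of H y x] * y by auto
      then have "(\<lambda>n. Y n (ereal z)) \<longlonglongrightarrow> H (ereal z)"
        using * by (auto simp: weak_conv_ddf_def weak_conv_def)
      then have "\<forall>\<^sub>F n in sequentially. a < Y n (ereal z)"
        using y z by (auto intro: order_tendstoD)
      then show "\<forall>\<^sub>F n in sequentially. Y n \<in> ?U"
      proof (rule eventually_mono)
        fix n assume "a < Y n (ereal z)"
        moreover have "Y n (ereal z) \<le> Y n (ereal x)"
          using * z by (intro Delta_plus_mono) auto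
        ultimately show "Y n \<in> ?U" using * by auto
      qed
    qed auto
    then have "\<forall>\<^sub>F n in sequentially. X n \<in> ?U"
      using L F a unfolding limitin_def by blast
    then show "\<forall>\<^sub>F n in sequentially. a < X n (ereal x)"
      by (rule eventually_mono) auto
  next
    fix x a :: real
    assume c: "isCont (\<lambda>x. F (ereal x)) x" and a: "F (ereal x) < a"
    let ?U = "{H \<in> Delta_plus. \<exists>y>x. H (ereal y) < a}"
    have "openin weak_topology ?U"
      unfolding openin_weak_topology
    proof (intro conjI allI impI)
      fix Y H assume *: "(\<forall>n. Y n \<in> Delta_plus) \<and> H \<in> ?U \<and> weak_conv_ddf Y H"
      then obtain y where y: "x < y" "H (ereal y) < a" by auto
      obtain z where z: "x < z" "z < y" "isCont (\<lambda>x. H (ereal x)) z"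
        using Delta_plus_isCont_between[of H x y] * y by auto
      have "H (ereal z) \<le> H (ereal y)"
        using * z by (intro Delta_plus_mono) auto
      moreover have "(\<lambda>n. Y n (ereal z)) \<longlonglongrightarrow> H (ereal z)"
        using * z by (auto simp: weak_conv_ddf_def weak_conv_def)
      ultimately have "\<forall>\<^sub>F n in sequentially. Y n (ereal z) < a"
        using y by (auto intro: order_tendstoD)
      then show "\<forall>\<^sub>F n in sequentially. Y n \<in> ?U"
        by (rule eventually_mono) (use * z in auto)
    qed auto
    moreover have "F \<in> ?U"
    proof -
      have "((\<lambda>y. F (ereal y)) \<longlongrightarrow> F (ereal x)) (at_right x)"
        using c by (simp add: isCont_def filterlim_at_split)
      then have "\<forall>\<^sub>F y in at_right x. F (ereal y) < a"
        using a by (rule order_tendstoD)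
      then obtain b where b: "b > x" "\<And>z. x < z \<Longrightarrow> z < b \<Longrightarrow> F (ereal z) < a"
        by (auto simp: eventually_at_right_field)
      obtain z where "x < z" "z < b" using dense[OF b(1)] by blast
      then show ?thesis using b(2) F by blast
    qed
    ultimately have "\<forall>\<^sub>F n in sequentially. X n \<in> ?U"
      using L unfolding limitin_def by blast
    then show "\<forall>\<^sub>F n in sequentially. X n (ereal x) < a"
    proof (rule eventually_mono)
      fix n assume "X n \<in> ?U"
      then obtain y where "x < y" "X n (ereal y) < a" by auto
      moreover have "X n (ereal x) \<le> X n (ereal y)"
        using X \<open>x < y\<close> by (intro Delta_plus_mono) auto
      ultimately show "X n (ereal x) < a" by simp
    qed
  qed
qed

end

theory Submission
  imports Defs
begin

text \<open>
  Replacing \<open>F\<close>, \<open>G\<close> by \<open>1 - F\<close>, \<open>1 - G\<close> turns the infimal convolution of the dual conorm into the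
  supremal convolution of \<open>T\<close>, so both triangle functions inherit their algebraic laws from a single
  operation on \<open>[0,1]\<close>-valued functions on the line. Weak convergence is described by Levy-type
  entourages; in these terms the continuity of both triangle functions is just the uniform continuity
  of \<open>T\<close> on the unit square. For the norm, right continuity of \<open>f\<close> makes every strong neighbourhood
  open, and \<open>f r < 1\<close> for \<open>r > 0\<close> places one inside each ball, so the strong topology is the norm
  topology. Since \<open>\<nu> p\<close> is constant and below \<open>1\<close> on \<open>(0,\<infinity>)\<close> for \<open>p \<noteq> 0\<close>, no set with a
  nonzero point is \<open>\<D>\<close>-bounded.
\<close>

section \<open>Distance distribution functions\<close>

lemma Delta_plus_range: "F \<in> Delta_plus \<Longrightarrow> F x \<in> {0..1}"
  by (auto simp: Delta_plus_def)

lemma Delta_plus_nonpos: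
  assumes "F \<in> Delta_plus" "x \<le> 0" shows "F x = 0"
proof (rule antisym)
  show "F x \<le> 0" using Delta_plus_mono[OF assms] assms(1) by (simp add: Delta_plus_def)
qed (use Delta_plus_range[OF assms(1), of x] in simp)

lemma Delta_plus_infinity: "F \<in> Delta_plus \<Longrightarrow> F \<infinity> = 1 \<and> F (-\<infinity>) = 0"
  by (auto simp: Delta_plus_def)

text \<open>Left continuity in the form that fits lower semicontinuity of the t-norm: a strict lower
  bound on a value survives a small move of the argument to the left.\<close>

lemma Delta_plus_left:
  assumes F: "F \<in> Delta_plus" and c: "c < F (ereal s)"
  obtains s' where "s' < s" "c < F (ereal s')"
proof -
  have "((\<lambda>y. F (ereal y)) \<longlongrightarrow> F (ereal s)) (at_left s)"
    using F by (auto simp: Delta_plus_def continuous_within)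
  then have "\<forall>\<^sub>F y in at_left s. c < F (ereal y)"
    using c by (rule order_tendstoD)
  then obtain b where b: "b < s" "\<And>y. b < y \<Longrightarrow> y < s \<Longrightarrow> c < F (ereal y)"
    by (auto simp: eventually_at_left_field)
  obtain y where "b < y" "y < s"
    using dense[OF b(1)] by blast
  with b(2) that show thesis by blast
qed

lemma ereal_fun_leI:
  fixes F G :: "ereal \<Rightarrow> real"
  assumes "F \<infinity> \<le> G \<infinity>" "F (-\<infinity>) \<le> G (-\<infinity>)" "\<And>x. F (ereal x) \<le> G (ereal x)"
  shows "F \<le> G"
proof (rule le_funI)
  fix x show "F x \<le> G x" by (cases x) (use assms in auto)
qed

lemma ereal_fun_eqI:
  fixes F G :: "ereal \<Rightarrow> real"
  assumes "F \<infinity> = G \<infinity>" "F (-\<infinity>) = G (-\<infinity>)" "\<And>x. F (ereal x) = G (ereal x)"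
  shows "F = G"
  by (intro antisym ereal_fun_leI) (simp_all add: assms)

text \<open>Monotonicity gives the upper half of left continuity for free, so only strict lower
  bounds have to be carried to the left. The infinite arguments are settled by their prescribed
  values and the range.\<close>

lemma Delta_plusI:
  fixes F :: "ereal \<Rightarrow> real"
  assumes inf: "F \<infinity> = 1" "F (-\<infinity>) = 0" and zero: "F 0 = 0"
    and range: "\<And>x. F (ereal x) \<in> {0..1}"
    and mono: "\<And>x y. x \<le> y \<Longrightarrow> F (ereal x) \<le> F (ereal y)"
    and left: "\<And>x a. a < F (ereal x) \<Longrightarrow> \<exists>y<x. a < F (ereal y)"
  shows "F \<in> Delta_plus"
proof -
  have "F x \<in> {0..1}" for x
    using range by (cases x) (auto simp: inf)
  moreover have "mono F"
  proof (rule monoI)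
    fix x y :: ereal assume "x \<le> y"
    then show "F x \<le> F y"
      using range mono by (cases x; cases y) (auto simp: inf)
  qed
  moreover have "continuous (at_left x) (\<lambda>y. F (ereal y))" for x
    unfolding continuous_within
  proof (rule order_tendstoI)
    fix a assume "a < F (ereal x)"
    then obtain y where y: "y < x" "a < F (ereal y)"
      using left by blast
    then have "a < F (ereal z)" if "y < z" for z
      using mono[of y z] that by linarith
    then show "\<forall>\<^sub>F z in at_left x. a < F (ereal z)"
      using y by (auto simp: eventually_at_left_field)
  next
    fix a assume "F (ereal x) < a"
    then have "F (ereal z) < a" if "z < x" for z
      using mono[of z x] that by linarith
    then show "\<forall>\<^sub>F z in at_left x. F (ereal z) < a"
      by (auto simp: eventually_at_filter)
  qed
  ultimately show ?thesis
    using inf zero by (simp add: Delta_plus_def)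
qed

lemma eps0_Delta_plus: "eps0 \<in> Delta_plus"
proof (rule Delta_plusI)
  fix x a :: real assume a: "a < eps0 (ereal x)"
  then show "\<exists>y<x. a < eps0 (ereal y)"
    by (intro exI[of _ "if x \<le> 0 then x - 1 else x / 2"]) (auto simp: eps0_def split: if_splits)
qed (auto simp: eps0_def)

section \<open>Metrization of weak convergence\<close>

text \<open>A Levy-type entourage, with the comparison cut off at \<open>1 / \<eta>\<close>
  because mass may escape to infinity in \<open>Delta_plus\<close>.\<close>

definition below_upto :: "real \<Rightarrow> (ereal \<Rightarrow> real) \<Rightarrow> (ereal \<Rightarrow> real) \<Rightarrow> bool" where
  "below_upto \<eta> F G \<longleftrightarrow> (\<forall>s. \<eta> * s \<le> 1 \<longrightarrow> F (ereal s) \<le> G (ereal (s + \<eta>)) + \<eta>)"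

definition near :: "real \<Rightarrow> (ereal \<Rightarrow> real) \<Rightarrow> (ereal \<Rightarrow> real) \<Rightarrow> bool" where
  "near \<eta> F G \<longleftrightarrow> below_upto \<eta> F G \<and> below_upto \<eta> G F"

lemma below_upto_trans:
  assumes "below_upto (\<eta> / 2) F G" "below_upto (\<eta> / 2) G H" "0 < \<eta>" "\<eta> \<le> 1"
  shows "below_upto \<eta> F H"
  unfolding below_upto_def
proof (intro allI impI)
  fix s assume s: "\<eta> * s \<le> 1"
  \<comment> \<open>The second comparison is used at s + \<eta>/2, which must stay below its own
    cutoff 2/\<eta>. This is where \<eta> \<le> 1 enters.\<close>
  have "\<eta> * \<eta> \<le> 1" using assms by (simp add: mult_le_one)
  then have "\<eta> / 2 * s \<le> 1" "\<eta> / 2 * (s + \<eta> / 2) \<le> 1"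
    using s by (auto simp: algebra_simps)
  then have "F (ereal s) \<le> G (ereal (s + \<eta> / 2)) + \<eta> / 2"
    "G (ereal (s + \<eta> / 2)) \<le> H (ereal (s + \<eta> / 2 + \<eta> / 2)) + \<eta> / 2"
    using assms by (auto simp only: below_upto_def)
  then show "F (ereal s) \<le> H (ereal (s + \<eta>)) + \<eta>" by (simp add: add.commute)
qed

lemma near_trans:
  assumes "near (\<eta> / 2) F G" "near (\<eta> / 2) G H" "0 < \<eta>" "\<eta> \<le> 1"
  shows "near \<eta> F H"
  using assms below_upto_trans unfolding near_def by blast

lemma below_upto_weaken:
  assumes G: "G \<in> Delta_plus" and F: "F \<in> Delta_plus"
    and FG: "below_upto \<eta> F G" and \<eta>: "0 < \<eta>" "\<eta> \<le> \<zeta>"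
  shows "below_upto \<zeta> F G"
  unfolding below_upto_def
proof (intro allI impI)
  fix s assume s: "\<zeta> * s \<le> 1"
  show "F (ereal s) \<le> G (ereal (s + \<zeta>)) + \<zeta>"
  proof (cases "s \<le> 0")
    case True
    then show ?thesis
      using Delta_plus_nonpos[OF F, of "ereal s"] Delta_plus_range[OF G, of "ereal (s + \<zeta>)"] \<eta>
      by simp
  next
    case False
    then have "\<eta> * s \<le> 1" using s \<eta> mult_right_mono[of \<eta> \<zeta> s] by linarith
    then have "F (ereal s) \<le> G (ereal (s + \<eta>)) + \<eta>" using FG by (simp add: below_upto_def)
    then show ?thesis
      using Delta_plus_mono[OF G, of "ereal (s + \<eta>)" "ereal (s + \<zeta>)"] \<eta> by simp
  qed
qed

lemma near_weaken:
  assumes "G \<in> Delta_plus" "F \<in> Delta_plus" "near \<eta> F G" "0 < \<eta>" "\<eta> \<le> \<zeta>"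
  shows "near \<zeta> F G"
  using assms below_upto_weaken unfolding near_def by blast

lemma near_refl:
  assumes F: "F \<in> Delta_plus" and "0 < \<eta>"
  shows "near \<eta> F F"
proof -
  have "F (ereal s) \<le> F (ereal (s + \<eta>)) + \<eta>" for s
    using Delta_plus_mono[OF F, of "ereal s" "ereal (s + \<eta>)"] assms(2) by simp
  then show ?thesis by (auto simp: near_def below_upto_def)
qed

text \<open>The compact interval from 0 to 1/\<eta> is covered by finitely many intervals (z -
  \<eta>, z) with z a continuity point of F. Closeness at these finitely many z is enough, since for
  s in such an interval monotonicity gives H s \<le> H z and K z \<le> K (s + \<eta>).\<close>

lemma weak_conv_ddf_imp_near:
  assumes X: "\<And>n. X n \<in> Delta_plus" and F: "F \<in> Delta_plus"
    and conv: "weak_conv_ddf X F" and \<eta>: "0 < \<eta>"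
  shows "\<forall>\<^sub>F n in sequentially. near \<eta> F (X n)"
proof -
  define Z where "Z = {z. isCont (\<lambda>x. F (ereal x)) z}"
  have "{0..1 / \<eta>} \<subseteq> (\<Union>z\<in>Z. {z - \<eta><..<z})"
  proof
    fix s assume "s \<in> {0..1 / \<eta>}"
    obtain z where "s < z" "z < s + \<eta>" "z \<in> Z"
      using Delta_plus_isCont_between[OF F, of s "s + \<eta>"] \<eta> by (auto simp: Z_def)
    then show "s \<in> (\<Union>z\<in>Z. {z - \<eta><..<z})" by force
  qed
  then obtain C where C: "C \<subseteq> Z" "finite C" "{0..1 / \<eta>} \<subseteq> (\<Union>z\<in>C. {z - \<eta><..<z})"
    using compactE_image[of "{0..1 / \<eta>}" Z "\<lambda>z. {z - \<eta><..<z}"] by auto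
  have "\<forall>\<^sub>F n in sequentially. \<bar>X n (ereal z) - F (ereal z)\<bar> < \<eta>" if "z \<in> C" for z
  proof -
    have "(\<lambda>n. X n (ereal z)) \<longlonglongrightarrow> F (ereal z)"
      using conv C that by (auto simp: weak_conv_ddf_def weak_conv_def Z_def)
    then show ?thesis using \<eta> by (auto simp: tendsto_iff dist_real_def)
  qed
  then have "\<forall>\<^sub>F n in sequentially. \<forall>z\<in>C. \<bar>X n (ereal z) - F (ereal z)\<bar> < \<eta>"
    using C by (simp add: eventually_ball_finite)
  then show ?thesis
  proof (rule eventually_mono)
    fix n assume n: "\<forall>z\<in>C. \<bar>X n (ereal z) - F (ereal z)\<bar> < \<eta>"
    have "below_upto \<eta> H K"
      if H: "H \<in> Delta_plus" and K: "K \<in> Delta_plus"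
        and HK: "\<And>z. z \<in> C \<Longrightarrow> H (ereal z) \<le> K (ereal z) + \<eta>" for H K
      unfolding below_upto_def
    proof (intro allI impI)
      fix s assume s: "\<eta> * s \<le> 1"
      show "H (ereal s) \<le> K (ereal (s + \<eta>)) + \<eta>"
      proof (cases "s \<le> 0")
        case True
        then show ?thesis
          using Delta_plus_nonpos[OF H, of "ereal s"] Delta_plus_range[OF K, of "ereal (s + \<eta>)"] \<eta>
          by simp
      next
        case False
        then have "s \<in> {0..1 / \<eta>}" using s \<eta> by (simp add: field_simps)
        then obtain z where z: "z \<in> C" "z - \<eta> < s" "s < z" using C by force
        have "H (ereal s) \<le> H (ereal z)" "K (ereal z) \<le> K (ereal (s + \<eta>))"
          using z by (auto intro!: Delta_plus_mono H K)
        with HK[OF z(1)] show ?thesis by linarith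
      qed
    qed
    from this[OF F X] this[OF X F] n show "near \<eta> F (X n)"
      unfolding near_def by force
  qed
qed

text \<open>At a continuity point x of F, the value of \<open>X n\<close> is squeezed between F (x -
  e) - e and F (x + e) + e, where e = 1/(n + 1) tends to 0.\<close>

lemma near_imp_weak_conv_ddf:
  assumes near: "\<And>n. near (inverse (real (Suc n))) F (X n)"
  shows "weak_conv_ddf X F"
  unfolding weak_conv_ddf_def weak_conv_def
proof (intro allI impI)
  fix x assume c: "isCont (\<lambda>x. F (ereal x)) x"
  define e where "e n = inverse (real (Suc n))" for n
  have e: "e \<longlonglongrightarrow> 0"
    unfolding e_def by (rule LIMSEQ_inverse_real_of_nat)
  have "(\<lambda>n. F (ereal (x - e n)) - e n) \<longlonglongrightarrow> F (ereal (x - 0)) - 0"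
    by (intro tendsto_diff e isCont_tendsto_compose[of _ "\<lambda>x. F (ereal x)"]) (use c in auto)
  then have lower: "(\<lambda>n. F (ereal (x - e n)) - e n) \<longlonglongrightarrow> F (ereal x)" by simp
  have "(\<lambda>n. F (ereal (x + e n)) + e n) \<longlonglongrightarrow> F (ereal (x + 0)) + 0"
    by (intro tendsto_add e tendsto_const isCont_tendsto_compose[of _ "\<lambda>x. F (ereal x)"])
      (use c in auto)
  then have upper: "(\<lambda>n. F (ereal (x + e n)) + e n) \<longlonglongrightarrow> F (ereal x)" by simp
  \<comment> \<open>A fixed argument eventually lies below the cutoff 1/e, which tends to
    infinity.\<close>
  have cutoff: "\<forall>\<^sub>F n in sequentially. e n * y \<le> 1" for y
  proof -
    have "(\<lambda>n. e n * y) \<longlonglongrightarrow> 0 * y" by (intro tendsto_intros e)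
    then have "\<forall>\<^sub>F n in sequentially. e n * y < 1" by (auto intro: order_tendstoD)
    then show ?thesis by (rule eventually_mono) simp
  qed
  have e_pos: "e n > 0" for n by (simp add: e_def)
  have nr: "near (e n) F (X n)" for n using near by (simp add: e_def)
  show "(\<lambda>n. X n (ereal x)) \<longlonglongrightarrow> F (ereal x)"
  proof (rule tendsto_sandwich[OF _ _ lower upper])
    show "\<forall>\<^sub>F n in sequentially. F (ereal (x - e n)) - e n \<le> X n (ereal x)"
      using cutoff[of x]
    proof (rule eventually_mono)
      fix n assume "e n * x \<le> 1"
      then have "e n * (x - e n) \<le> 1"
        using e_pos[of n] by (simp add: algebra_simps add_increasing2)
      then show "F (ereal (x - e n)) - e n \<le> X n (ereal x)"
        using nr[of n] by (fastforce simp: near_def below_upto_def)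
    qed
    show "\<forall>\<^sub>F n in sequentially. X n (ereal x) \<le> F (ereal (x + e n)) + e n"
      using cutoff[of x]
      by (rule eventually_mono) (use nr in \<open>auto simp: near_def below_upto_def\<close>)
  qed
qed

text \<open>Neighbourhoods, unlike the sequential definition, can be fed into the product topology.
  If no entourage of F fits in U, the sizes 1/(n + 1) yield a sequence outside U that converges
  weakly to F. Conversely, a weakly convergent sequence eventually enters every entourage of its
  limit.\<close>

lemma openin_weak_topology_near:
  "openin weak_topology U \<longleftrightarrow> U \<subseteq> Delta_plus \<and>
     (\<forall>F\<in>U. \<exists>\<eta>>0. \<forall>G\<in>Delta_plus. near \<eta> F G \<longrightarrow> G \<in> U)"
proof
  assume op: "openin weak_topology U"
  have "\<exists>\<eta>>0. \<forall>G\<in>Delta_plus. near \<eta> F G \<longrightarrow> G \<in> U" if F: "F \<in> U" for F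
  proof (rule ccontr)
    assume neg: "\<not> ?thesis"
    have "\<forall>n. \<exists>G. G \<in> Delta_plus \<and> near (inverse (real (Suc n))) F G \<and> G \<notin> U"
    proof
      fix n show "\<exists>G. G \<in> Delta_plus \<and> near (inverse (real (Suc n))) F G \<and> G \<notin> U"
        using neg inverse_positive_iff_positive[of "real (Suc n)"] by (metis of_nat_0_less_iff zero_less_Suc)
    qed
    then obtain X where X: "\<And>n. X n \<in> Delta_plus" "\<And>n. near (inverse (real (Suc n))) F (X n)"
      "\<And>n. X n \<notin> U" by metis
    have "weak_conv_ddf X F" by (rule near_imp_weak_conv_ddf) (rule X(2))
    then have "\<forall>\<^sub>F n in sequentially. X n \<in> U"
      using op X(1) F by (auto simp: openin_weak_topology)
    with X(3) show False by simp
  qed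
  then show "U \<subseteq> Delta_plus \<and> (\<forall>F\<in>U. \<exists>\<eta>>0. \<forall>G\<in>Delta_plus. near \<eta> F G \<longrightarrow> G \<in> U)"
    using op by (auto simp: openin_weak_topology)
next
  assume U: "U \<subseteq> Delta_plus \<and> (\<forall>F\<in>U. \<exists>\<eta>>0. \<forall>G\<in>Delta_plus. near \<eta> F G \<longrightarrow> G \<in> U)"
  show "openin weak_topology U"
    unfolding openin_weak_topology
  proof (intro conjI allI impI)
    fix X F assume *: "(\<forall>n. X n \<in> Delta_plus) \<and> F \<in> U \<and> weak_conv_ddf X F"
    then obtain \<eta> where \<eta>: "\<eta> > 0" "\<And>G. G \<in> Delta_plus \<Longrightarrow> near \<eta> F G \<Longrightarrow> G \<in> U"
      using U by blast
    have "\<forall>\<^sub>F n in sequentially. near \<eta> F (X n)"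
      using * U \<eta> by (intro weak_conv_ddf_imp_near) auto
    then show "\<forall>\<^sub>F n in sequentially. X n \<in> U"
      by (rule eventually_mono) (use * \<eta> in auto)
  qed (use U in auto)
qed

text \<open>The ball \<open>near \<eta> F\<close> need not be open itself, so its interior is taken:
  the points that have a whole ball inside it. That this set is open follows by halving radii with
  \<open>near_trans\<close>.\<close>

lemma near_neighbourhood:
  assumes F: "F \<in> Delta_plus" and \<eta>: "0 < \<eta>"
  obtains U where "openin weak_topology U" "F \<in> U" "\<And>G. G \<in> U \<Longrightarrow> near \<eta> F G"
proof
  let ?U = "{H \<in> Delta_plus. \<exists>\<zeta>>0. \<forall>K\<in>Delta_plus. near \<zeta> H K \<longrightarrow> near \<eta> F K}"
  show "openin weak_topology ?U"
    unfolding openin_weak_topology_near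
  proof (intro conjI ballI)
    fix H assume "H \<in> ?U"
    then obtain \<zeta> where H: "H \<in> Delta_plus" and \<zeta>: "\<zeta> > 0"
      and \<zeta>H: "\<And>K. K \<in> Delta_plus \<Longrightarrow> near \<zeta> H K \<Longrightarrow> near \<eta> F K" by blast
    \<comment> \<open>The bound 1 is required by \<open>near_trans\<close>.\<close>
    define \<xi> where "\<xi> = min \<zeta> 1"
    have \<xi>: "0 < \<xi>" "\<xi> \<le> \<zeta>" "\<xi> \<le> 1" using \<zeta> by (auto simp: \<xi>_def)
    have "near \<eta> F K" if "near (\<xi> / 2) H G" "near (\<xi> / 2) G K" "K \<in> Delta_plus" for G K
      using near_weaken[OF that(3) H near_trans[OF that(1,2) \<xi>(1,3)] \<xi>(1,2)] \<zeta>H that(3) by blast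
    then show "\<exists>\<eta>'>0. \<forall>G\<in>Delta_plus. near \<eta>' H G \<longrightarrow> G \<in> ?U"
      using \<xi> by (intro exI[of _ "\<xi> / 2"]) (auto intro!: exI[of _ "\<xi> / 2"])
  qed auto
  show "F \<in> ?U" using F \<eta> by auto
  show "near \<eta> F G" if "G \<in> ?U" for G
    using that near_refl by blast
qed

text \<open>A one-sided modulus suffices because it is uniform: applied once to (F, F') and once to
  (F', F) it gives both halves of \<open>near\<close>.\<close>

lemma continuous_map_weak_topologyI:
  assumes closed: "\<And>F G. F \<in> Delta_plus \<Longrightarrow> G \<in> Delta_plus \<Longrightarrow> \<tau> F G \<in> Delta_plus"
    and modulus: "\<And>\<delta>. 0 < \<delta> \<Longrightarrow> \<exists>\<eta>>0. \<forall>F\<in>Delta_plus. \<forall>F'\<in>Delta_plus. \<forall>G\<in>Delta_plus. \<forall>G'\<in>Delta_plus.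
      below_upto \<eta> F F' \<longrightarrow> below_upto \<eta> G G' \<longrightarrow> below_upto \<delta> (\<tau> F G) (\<tau> F' G')"
  shows "continuous_map (prod_topology weak_topology weak_topology) weak_topology (\<lambda>(F, G). \<tau> F G)"
  unfolding continuous_map_def
proof (intro conjI allI impI)
  show "(\<lambda>(F, G). \<tau> F G) \<in> topspace (prod_topology weak_topology weak_topology)
      \<rightarrow> topspace weak_topology"
    using closed by auto
  fix U assume U: "openin weak_topology U"
  let ?P = "{x \<in> topspace (prod_topology weak_topology weak_topology). (\<lambda>(F, G). \<tau> F G) x \<in> U}"
  have "\<exists>A B. openin weak_topology A \<and> openin weak_topology B \<and> (F, G) \<in> A \<times> B \<and> A \<times> B \<subseteq> ?P"
    if FG: "F \<in> Delta_plus" "G \<in> Delta_plus" "\<tau> F G \<in> U" for F G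
  proof -
    obtain \<delta> where \<delta>: "\<delta> > 0" "\<And>H. H \<in> Delta_plus \<Longrightarrow> near \<delta> (\<tau> F G) H \<Longrightarrow> H \<in> U"
      using U FG by (meson openin_weak_topology_near)
    obtain \<eta> where \<eta>: "\<eta> > 0" and mod: "\<And>F F' G G'. F \<in> Delta_plus \<Longrightarrow> F' \<in> Delta_plus \<Longrightarrow>
        G \<in> Delta_plus \<Longrightarrow> G' \<in> Delta_plus \<Longrightarrow> below_upto \<eta> F F' \<Longrightarrow> below_upto \<eta> G G' \<Longrightarrow>
        below_upto \<delta> (\<tau> F G) (\<tau> F' G')"
      using modulus[OF \<delta>(1)] by blast
    obtain A where A: "openin weak_topology A" "F \<in> A" "\<And>F'. F' \<in> A \<Longrightarrow> near \<eta> F F'"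
      using near_neighbourhood[OF FG(1) \<eta>] by blast
    obtain B where B: "openin weak_topology B" "G \<in> B" "\<And>G'. G' \<in> B \<Longrightarrow> near \<eta> G G'"
      using near_neighbourhood[OF FG(2) \<eta>] by blast
    have AB: "A \<subseteq> Delta_plus" "B \<subseteq> Delta_plus"
      using A B openin_subset by force+
    have "\<tau> F' G' \<in> U" if "F' \<in> A" "G' \<in> B" for F' G'
      using that A(3)[OF that(1)] B(3)[OF that(2)] AB FG
      by (intro \<delta>(2) closed) (auto simp: near_def intro!: mod)
    with A B AB show ?thesis by (intro exI[of _ A] exI[of _ B]) auto
  qed
  then show "openin (prod_topology weak_topology weak_topology) ?P"
    unfolding openin_prod_topology_alt by auto
qed

section \<open>The two convolutions of a continuous t-norm\<close>

text \<open>The arguments are arbitrary real functions, neither monotone nor zero at 0, so that the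
  same operation serves F as well as 1 - F.\<close>

definition sup_conv :: "(real \<Rightarrow> real \<Rightarrow> real) \<Rightarrow> (real \<Rightarrow> real) \<Rightarrow> (real \<Rightarrow> real) \<Rightarrow> real \<Rightarrow> real" where
  "sup_conv T u v x = (SUP s. T (u s) (v (x - s)))"

locale cont_tnorm =
  fixes T :: "real \<Rightarrow> real \<Rightarrow> real"
  assumes cont_tnorm: "continuous_tnorm T"
begin

section \<open>Elementary bounds and uniform continuity of a continuous t-norm\<close>

lemma tnorm: "tnorm T"
  using cont_tnorm by (simp add: continuous_tnorm_def)

lemma range: "x \<in> {0..1} \<Longrightarrow> y \<in> {0..1} \<Longrightarrow> T x y \<in> {0..1}"
  using tnorm unfolding tnorm_def by blast

lemma commute: "x \<in> {0..1} \<Longrightarrow> y \<in> {0..1} \<Longrightarrow> T x y = T y x"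
  using tnorm unfolding tnorm_def by blast

lemma assoc: "x \<in> {0..1} \<Longrightarrow> y \<in> {0..1} \<Longrightarrow> z \<in> {0..1} \<Longrightarrow> T (T x y) z = T x (T y z)"
  using tnorm unfolding tnorm_def by blast

lemma mono: "x \<in> {0..1} \<Longrightarrow> x' \<in> {0..1} \<Longrightarrow> y \<in> {0..1} \<Longrightarrow> y' \<in> {0..1} \<Longrightarrow>
    x \<le> x' \<Longrightarrow> y \<le> y' \<Longrightarrow> T x y \<le> T x' y'"
  using tnorm unfolding tnorm_def by blast

lemma one_right: "x \<in> {0..1} \<Longrightarrow> T x 1 = x"
  using tnorm unfolding tnorm_def by blast

lemma le_left: "x \<in> {0..1} \<Longrightarrow> y \<in> {0..1} \<Longrightarrow> T x y \<le> x"
  using mono[of x x y 1] one_right[of x] by auto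

lemma le_right: "x \<in> {0..1} \<Longrightarrow> y \<in> {0..1} \<Longrightarrow> T x y \<le> y"
  using le_left[of y x] commute[of x y] by simp

lemma zero_left: "y \<in> {0..1} \<Longrightarrow> T 0 y = 0"
  using le_left[of 0 y] range[of 0 y] by simp

lemma zero_right: "x \<in> {0..1} \<Longrightarrow> T x 0 = 0"
  using le_right[of x 0] range[of x 0] by simp

text \<open>Uniform continuity on the compact square combined with monotonicity. Only upper bounds
  on x - x' and y - y' are assumed, which is exactly what \<open>below_upto\<close>
  provides.\<close>

lemma modulus:
  assumes "0 < \<epsilon>"
  obtains \<eta> where "0 < \<eta>"
    "\<And>x x' y y'. x \<in> {0..1} \<Longrightarrow> x' \<in> {0..1} \<Longrightarrow> y \<in> {0..1} \<Longrightarrow> y' \<in> {0..1} \<Longrightarrow>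
      x \<le> x' + \<eta> \<Longrightarrow> y \<le> y' + \<eta> \<Longrightarrow> T x y \<le> T x' y' + \<epsilon>"
proof -
  have "uniformly_continuous_on ({0..1} \<times> {0..1}) (\<lambda>(x, y). T x y)"
    using cont_tnorm
    by (auto simp: continuous_tnorm_def intro!: compact_uniformly_continuous compact_Times)
  then obtain d where d: "0 < d" "\<And>p q. p \<in> {0..1} \<times> {0..1} \<Longrightarrow> q \<in> {0..1} \<times> {0..1} \<Longrightarrow>
      dist q p < d \<Longrightarrow> dist ((\<lambda>(x, y). T x y) q) ((\<lambda>(x, y). T x y) p) < \<epsilon>"
    using assms unfolding uniformly_continuous_on_def by metis
  have "T x y \<le> T x' y' + \<epsilon>"
    if xy: "x \<in> {0..1}" "x' \<in> {0..1}" "y \<in> {0..1}" "y' \<in> {0..1}" "x \<le> x' + d / 3" "y \<le> y' + d / 3"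
    for x x' y y'
  proof -
    \<comment> \<open>Replacing x by max x x' can only increase T and lands within d/3 of x'. The
      same holds for y, so the two displacements together stay below d.\<close>
    have "dist (max x x', max y y') (x', y') \<le> dist (max x x') x' + dist (max y y') y'"
      unfolding dist_prod_def by (simp add: sqrt_sum_squares_le_sum)
    also have "\<dots> < d" using xy d(1) by (auto simp: dist_real_def max_def)
    finally have "dist (T (max x x') (max y y')) (T x' y') < \<epsilon>"
      using d(2)[of "(x', y')" "(max x x', max y y')"] xy by (simp add: max_def)
    moreover have "T x y \<le> T (max x x') (max y y')"
      using xy by (intro mono) auto
    ultimately show ?thesis by (simp add: dist_real_def)
  qed
  with that[of "d / 3"] d(1) show thesis by simp
qed

text \<open>The thresholds come from \<open>modulus\<close> with half of the gap between a and T x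
  y, which keeps the resulting inequality strict.\<close>

lemma lower_semicont:
  assumes "x \<in> {0..1}" "y \<in> {0..1}" "a < T x y"
  obtains c d where "c < x" "d < y"
    "\<And>x' y'. x' \<in> {0..1} \<Longrightarrow> y' \<in> {0..1} \<Longrightarrow> c < x' \<Longrightarrow> d < y' \<Longrightarrow> a < T x' y'"
proof -
  obtain \<eta> where \<eta>: "0 < \<eta>" "\<And>w x' z y'. w \<in> {0..1} \<Longrightarrow> x' \<in> {0..1} \<Longrightarrow> z \<in> {0..1} \<Longrightarrow>
      y' \<in> {0..1} \<Longrightarrow> w \<le> x' + \<eta> \<Longrightarrow> z \<le> y' + \<eta> \<Longrightarrow> T w z \<le> T x' y' + (T x y - a) / 2"
    by (rule modulus[of "(T x y - a) / 2"]) (use assms(3) in \<open>simp, blast\<close>)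
  show thesis
  proof (rule that)
    show "x - \<eta> < x" "y - \<eta> < y" using \<eta> by auto
    fix x' y' assume "x' \<in> {0..1}" "y' \<in> {0..1}" "x - \<eta> < x'" "y - \<eta> < y'"
    then have "T x y \<le> T x' y' + (T x y - a) / 2" using assms by (intro \<eta>(2)) auto
    then show "a < T x' y'" using assms(3) by (simp add: field_simps)
  qed
qed

section \<open>Algebra of the supremal convolution\<close>

lemma sup_conv_bdd:
  assumes "u \<in> UNIV \<rightarrow> {0..1}" "v \<in> UNIV \<rightarrow> {0..1}"
  shows "bdd_above (range (\<lambda>s. T (u s) (v (x - s))))"
  using range[OF funcset_mem[OF assms(1) UNIV_I] funcset_mem[OF assms(2) UNIV_I]]
  by (intro bdd_aboveI[of _ 1]) auto

lemma sup_conv_upper: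
  assumes "u \<in> UNIV \<rightarrow> {0..1}" "v \<in> UNIV \<rightarrow> {0..1}"
  shows "T (u s) (v (x - s)) \<le> sup_conv T u v x"
  unfolding sup_conv_def by (intro cSUP_upper sup_conv_bdd assms) auto

lemma sup_conv_least:
  assumes "\<And>s. T (u s) (v (x - s)) \<le> c"
  shows "sup_conv T u v x \<le> c"
  unfolding sup_conv_def by (intro cSUP_least assms) auto

lemma less_sup_conv:
  assumes "u \<in> UNIV \<rightarrow> {0..1}" "v \<in> UNIV \<rightarrow> {0..1}"
  shows "a < sup_conv T u v x \<longleftrightarrow> (\<exists>s. a < T (u s) (v (x - s)))"
  unfolding sup_conv_def by (subst less_cSUP_iff) (simp_all add: sup_conv_bdd[OF assms])

lemma sup_conv_range:
  assumes u: "u \<in> UNIV \<rightarrow> {0..1}" and v: "v \<in> UNIV \<rightarrow> {0..1}"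
  shows "sup_conv T u v \<in> UNIV \<rightarrow> {0..1}"
proof
  fix x
  note rg = range[OF funcset_mem[OF u UNIV_I] funcset_mem[OF v UNIV_I]]
  have "sup_conv T u v x \<le> 1"
    by (rule sup_conv_least) (use rg in auto)
  moreover have "0 \<le> sup_conv T u v x"
    using rg[of 0 x] sup_conv_upper[OF u v, of 0 x] by simp
  ultimately show "sup_conv T u v x \<in> {0..1}" by simp
qed

lemma sup_conv_commute:
  assumes u: "u \<in> UNIV \<rightarrow> {0..1}" and v: "v \<in> UNIV \<rightarrow> {0..1}"
  shows "sup_conv T u v = sup_conv T v u"
proof -
  have "sup_conv T u v x \<le> sup_conv T v u x"
    if "u \<in> UNIV \<rightarrow> {0..1}" "v \<in> UNIV \<rightarrow> {0..1}" for u v x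
  proof (rule sup_conv_least)
    fix s
    show "T (u s) (v (x - s)) \<le> sup_conv T v u x"
      using sup_conv_upper[OF that(2,1), of "x - s" x]
        commute[OF funcset_mem[OF that(1) UNIV_I] funcset_mem[OF that(2) UNIV_I]] by simp
  qed
  from this[OF u v] this[OF v u] show ?thesis by (intro ext antisym)
qed

lemma sup_conv_mono:
  assumes u: "u \<in> UNIV \<rightarrow> {0..1}" "u' \<in> UNIV \<rightarrow> {0..1}" "\<And>s. u s \<le> u' s"
    and v: "v \<in> UNIV \<rightarrow> {0..1}" "v' \<in> UNIV \<rightarrow> {0..1}" "\<And>s. v s \<le> v' s"
  shows "sup_conv T u v x \<le> sup_conv T u' v' x"
proof (rule sup_conv_least)
  fix s
  have "T (u s) (v (x - s)) \<le> T (u' s) (v' (x - s))"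
    by (intro mono u(3) v(3) funcset_mem[OF u(1)] funcset_mem[OF u(2)] funcset_mem[OF v(1)]
        funcset_mem[OF v(2)] UNIV_I)
  also have "\<dots> \<le> sup_conv T u' v' x" by (intro sup_conv_upper u v)
  finally show "T (u s) (v (x - s)) \<le> sup_conv T u' v' x" .
qed

text \<open>If the inequality failed at x, some s would witness it. Lower semicontinuity of T then
  allows the inner supremum at s to be replaced by one of its terms, with parameter r, and
  associativity of T regroups that term into one of the right-hand side.\<close>

lemma sup_conv_assoc_le:
  assumes u: "u \<in> UNIV \<rightarrow> {0..1}" and v: "v \<in> UNIV \<rightarrow> {0..1}" and w: "w \<in> UNIV \<rightarrow> {0..1}"
  shows "sup_conv T (sup_conv T u v) w x \<le> sup_conv T u (sup_conv T v w) x"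
proof (rule ccontr)
  assume "\<not> ?thesis"
  then obtain s where s: "sup_conv T u (sup_conv T v w) x < T (sup_conv T u v s) (w (x - s))"
    using less_sup_conv[OF sup_conv_range[OF u v] w] by (auto simp: not_le)
  note rg = funcset_mem[OF u UNIV_I] funcset_mem[OF v UNIV_I] funcset_mem[OF w UNIV_I]
    funcset_mem[OF sup_conv_range[OF v w] UNIV_I]
  obtain c d where c: "c < sup_conv T u v s" "d < w (x - s)" "\<And>a b. a \<in> {0..1} \<Longrightarrow> b \<in> {0..1} \<Longrightarrow>
      c < a \<Longrightarrow> d < b \<Longrightarrow> sup_conv T u (sup_conv T v w) x < T a b"
    using lower_semicont[OF funcset_mem[OF sup_conv_range[OF u v] UNIV_I] rg(3) s] by blast
  obtain r where r: "c < T (u r) (v (s - r))"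
    using c(1) less_sup_conv[OF u v] by blast
  have "sup_conv T u (sup_conv T v w) x < T (T (u r) (v (s - r))) (w (x - s))"
    by (intro c r range rg)
  also have "\<dots> = T (u r) (T (v (s - r)) (w (x - s)))"
    by (intro assoc rg)
  also have "\<dots> \<le> T (u r) (sup_conv T v w (x - r))"
    using sup_conv_upper[OF v w, of "s - r" "x - r"]
    by (intro mono rg range) auto
  also have "\<dots> \<le> sup_conv T u (sup_conv T v w) x"
    by (intro sup_conv_upper u sup_conv_range v w)
  finally show False by simp
qed

lemma sup_conv_assoc:
  assumes u: "u \<in> UNIV \<rightarrow> {0..1}" and v: "v \<in> UNIV \<rightarrow> {0..1}" and w: "w \<in> UNIV \<rightarrow> {0..1}"
  shows "sup_conv T (sup_conv T u v) w = sup_conv T u (sup_conv T v w)"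
proof (rule ext, rule antisym[OF sup_conv_assoc_le[OF u v w]])
  fix x
  \<comment> \<open>The reverse inequality is the one already proved, applied to the reversed triple
    w, v, u and read through commutativity.\<close>
  have "sup_conv T u (sup_conv T v w) x = sup_conv T (sup_conv T w v) u x"
    using sup_conv_commute[OF u sup_conv_range[OF v w]] sup_conv_commute[OF v w] by simp
  also have "\<dots> \<le> sup_conv T w (sup_conv T v u) x"
    by (intro sup_conv_assoc_le u v w)
  also have "\<dots> = sup_conv T (sup_conv T u v) w x"
    using sup_conv_commute[OF sup_conv_range[OF u v] w] sup_conv_commute[OF u v] by simp
  finally show "sup_conv T u (sup_conv T v w) x \<le> sup_conv T (sup_conv T u v) w x" .
qed

section \<open>The triangle functions as supremal convolutions\<close>

lemma tau_sup_ereal: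
  "tau_sup T F G (ereal x) = sup_conv T (\<lambda>s. F (ereal s)) (\<lambda>s. G (ereal s)) x"
proof -
  have "{T (F (ereal s)) (G (ereal t)) | s t :: real. ereal (s + t) = ereal x}
      = range (\<lambda>s. T (F (ereal s)) (G (ereal (x - s))))"
  proof (intro set_eqI iffI)
    fix y assume "y \<in> range (\<lambda>s. T (F (ereal s)) (G (ereal (x - s))))"
    then obtain s where "y = T (F (ereal s)) (G (ereal (x - s)))" by blast
    then show "y \<in> {T (F (ereal s)) (G (ereal t)) | s t :: real. ereal (s + t) = ereal x}"
      by (intro CollectI exI[of _ s] exI[of _ "x - s"]) simp
  next
    fix y assume "y \<in> {T (F (ereal s)) (G (ereal t)) | s t :: real. ereal (s + t) = ereal x}"
    then obtain s t where y: "y = T (F (ereal s)) (G (ereal t))" and "s + t = x" by auto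
    then have t: "t = x - s" by simp
    then show "y \<in> range (\<lambda>s. T (F (ereal s)) (G (ereal (x - s))))" unfolding y t by simp
  qed
  then show ?thesis by (simp add: tau_sup_def sup_conv_def)
qed

text \<open>The decompositions s + t = x are parametrized by s. Complementation exchanges infimum
  and supremum, both taken over bounded nonempty sets because T has values in [0,1].\<close>

lemma tau_inf_ereal:
  assumes F: "F \<in> Delta_plus" and G: "G \<in> Delta_plus"
  shows "tau_inf (dual_conorm T) F G (ereal x)
    = 1 - sup_conv T (\<lambda>s. 1 - F (ereal s)) (\<lambda>s. 1 - G (ereal s)) x"
proof -
  let ?g = "\<lambda>s. T (1 - F (ereal s)) (1 - G (ereal (x - s)))"
  have F': "1 - F s \<in> {0..1}" and G': "1 - G s \<in> {0..1}" for s
    using Delta_plus_range[OF F, of s] Delta_plus_range[OF G, of s] by auto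
  have bd: "?g s \<in> {0..1}" for s by (intro range F' G')
  have bdd: "bdd_below (range (\<lambda>s. 1 - ?g s))" "bdd_above (range ?g)"
    using bd by (auto intro!: bdd_belowI[of _ 0] bdd_aboveI[of _ 1])
  have "{dual_conorm T (F (ereal s)) (G (ereal t)) | s t :: real. ereal (s + t) = ereal x}
      = range (\<lambda>s. 1 - ?g s)"
  proof (intro set_eqI iffI)
    fix y assume "y \<in> range (\<lambda>s. 1 - ?g s)"
    then obtain s where "y = 1 - ?g s" by blast
    then show "y \<in> {dual_conorm T (F (ereal s)) (G (ereal t)) | s t :: real. ereal (s + t) = ereal x}"
      by (intro CollectI exI[of _ s] exI[of _ "x - s"]) (simp add: dual_conorm_def)
  next
    fix y assume "y \<in> {dual_conorm T (F (ereal s)) (G (ereal t)) | s t :: real. ereal (s + t) = ereal x}"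
    then obtain s t where y: "y = dual_conorm T (F (ereal s)) (G (ereal t))" and "s + t = x" by auto
    then have t: "t = x - s" by simp
    then show "y \<in> range (\<lambda>s. 1 - ?g s)" unfolding y t by (simp add: dual_conorm_def)
  qed
  then have "tau_inf (dual_conorm T) F G (ereal x) = (INF s. 1 - ?g s)"
    by (simp add: tau_inf_def)
  also have "\<dots> = 1 - (SUP s. ?g s)"
  proof (rule antisym)
    have "(SUP s. ?g s) \<le> 1 - (INF s. 1 - ?g s)"
    proof (rule cSUP_least)
      fix s show "?g s \<le> 1 - (INF s. 1 - ?g s)"
        using cINF_lower[OF bdd(1), of s] by simp
    qed simp
    then show "(INF s. 1 - ?g s) \<le> 1 - (SUP s. ?g s)" by simp
    show "1 - (SUP s. ?g s) \<le> (INF s. 1 - ?g s)"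
      using cSUP_upper[OF _ bdd(2)] by (intro cINF_greatest) auto
  qed
  finally show ?thesis by (simp add: sup_conv_def)
qed

lemma tau_infinity [simp]:
  "tau_sup T F G \<infinity> = 1" "tau_sup T F G (-\<infinity>) = 0" "tau_inf S F G \<infinity> = 1" "tau_inf S F G (-\<infinity>) = 0"
  by (simp_all add: tau_sup_def tau_inf_def)

section \<open>The dual conorm\<close>

lemma conorm_range: "x \<in> {0..1} \<Longrightarrow> y \<in> {0..1} \<Longrightarrow> dual_conorm T x y \<in> {0..1}"
  using range[of "1 - x" "1 - y"] by (simp add: dual_conorm_def)

lemma conorm_mono: "x \<in> {0..1} \<Longrightarrow> x' \<in> {0..1} \<Longrightarrow> y \<in> {0..1} \<Longrightarrow> y' \<in> {0..1} \<Longrightarrow>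
    x \<le> x' \<Longrightarrow> y \<le> y' \<Longrightarrow> dual_conorm T x y \<le> dual_conorm T x' y'"
  using mono[of "1 - x'" "1 - x" "1 - y'" "1 - y"] by (simp add: dual_conorm_def)

lemma conorm_zero_right: "x \<in> {0..1} \<Longrightarrow> dual_conorm T x 0 = x"
  using one_right[of "1 - x"] by (simp add: dual_conorm_def)

lemma conorm_zero_left: "x \<in> {0..1} \<Longrightarrow> dual_conorm T 0 x = x"
  using one_right[of "1 - x"] commute[of "1 - x" 1] by (simp add: dual_conorm_def)

lemma conorm_ge_left: "x \<in> {0..1} \<Longrightarrow> y \<in> {0..1} \<Longrightarrow> x \<le> dual_conorm T x y"
  using le_left[of "1 - x" "1 - y"] by (simp add: dual_conorm_def)

lemma conorm_ge_right: "x \<in> {0..1} \<Longrightarrow> y \<in> {0..1} \<Longrightarrow> y \<le> dual_conorm T x y"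
  using le_right[of "1 - x" "1 - y"] by (simp add: dual_conorm_def)

text \<open>Complementation reverses the order, so \<open>modulus\<close> is applied with the primed
  and unprimed points exchanged: x \<le> x' + \<eta> becomes 1 - x' \<le> (1 - x) + \<eta>.\<close>

lemma conorm_modulus:
  assumes "0 < \<epsilon>"
  obtains \<eta> where "0 < \<eta>"
    "\<And>x x' y y'. x \<in> {0..1} \<Longrightarrow> x' \<in> {0..1} \<Longrightarrow> y \<in> {0..1} \<Longrightarrow> y' \<in> {0..1} \<Longrightarrow>
      x \<le> x' + \<eta> \<Longrightarrow> y \<le> y' + \<eta> \<Longrightarrow> dual_conorm T x y \<le> dual_conorm T x' y' + \<epsilon>"
proof -
  obtain \<eta> where \<eta>: "0 < \<eta>"
    "\<And>x x' y y'. x \<in> {0..1} \<Longrightarrow> x' \<in> {0..1} \<Longrightarrow> y \<in> {0..1} \<Longrightarrow> y' \<in> {0..1} \<Longrightarrow>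
      x \<le> x' + \<eta> \<Longrightarrow> y \<le> y' + \<eta> \<Longrightarrow> T x y \<le> T x' y' + \<epsilon>"
    using modulus[OF assms] by blast
  show thesis
  proof (rule that[OF \<eta>(1)])
    fix x x' y y' :: real
    assume "x \<in> {0..1}" "x' \<in> {0..1}" "y \<in> {0..1}" "y' \<in> {0..1}" "x \<le> x' + \<eta>" "y \<le> y' + \<eta>"
    then have "T (1 - x') (1 - y') \<le> T (1 - x) (1 - y) + \<epsilon>" by (intro \<eta>(2)) auto
    then show "dual_conorm T x y \<le> dual_conorm T x' y' + \<epsilon>" by (simp add: dual_conorm_def)
  qed
qed

lemma conorm_lower_semicont:
  assumes "x \<in> {0..1}" "y \<in> {0..1}" "a < dual_conorm T x y"
  obtains c d where "c < x" "d < y"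
    "\<And>x' y'. x' \<in> {0..1} \<Longrightarrow> y' \<in> {0..1} \<Longrightarrow> c < x' \<Longrightarrow> d < y' \<Longrightarrow> a < dual_conorm T x' y'"
proof -
  define \<epsilon> where "\<epsilon> = (dual_conorm T x y - a) / 2"
  have \<epsilon>: "\<epsilon> > 0" using assms by (simp add: \<epsilon>_def)
  obtain \<eta> where \<eta>: "0 < \<eta>" "\<And>x x' y y'. x \<in> {0..1} \<Longrightarrow> x' \<in> {0..1} \<Longrightarrow> y \<in> {0..1} \<Longrightarrow>
      y' \<in> {0..1} \<Longrightarrow> x \<le> x' + \<eta> \<Longrightarrow> y \<le> y' + \<eta> \<Longrightarrow>
      dual_conorm T x y \<le> dual_conorm T x' y' + \<epsilon>"
    using conorm_modulus[OF \<epsilon>] by blast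
  show thesis
  proof (rule that)
    show "x - \<eta> < x" "y - \<eta> < y" using \<eta> by auto
    fix x' y' assume "x' \<in> {0..1}" "y' \<in> {0..1}" "x - \<eta> < x'" "y - \<eta> < y'"
    then have "dual_conorm T x y \<le> dual_conorm T x' y' + \<epsilon>" using assms by (intro \<eta>(2)) auto
    then show "a < dual_conorm T x' y'" using assms(3) by (simp add: \<epsilon>_def field_simps)
  qed
qed

section \<open>Bounds for the two convolutions and closure of \<open>Delta_plus\<close>\<close>

lemma Delta_plus_funcset:
  assumes "F \<in> Delta_plus"
  shows "(\<lambda>s. F (ereal s)) \<in> UNIV \<rightarrow> {0..1}" "(\<lambda>s. 1 - F (ereal s)) \<in> UNIV \<rightarrow> {0..1}"
  using Delta_plus_range[OF assms] by auto

lemma tau_sup_upper: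
  assumes "F \<in> Delta_plus" "G \<in> Delta_plus" "s + t = x"
  shows "T (F (ereal s)) (G (ereal t)) \<le> tau_sup T F G (ereal x)"
  using sup_conv_upper[OF Delta_plus_funcset(1)[OF assms(1)] Delta_plus_funcset(1)[OF assms(2)], of s x]
    assms(3) by (auto simp: tau_sup_ereal)

lemma tau_sup_least:
  assumes "\<And>s t. s + t = x \<Longrightarrow> T (F (ereal s)) (G (ereal t)) \<le> c"
  shows "tau_sup T F G (ereal x) \<le> c"
  unfolding tau_sup_ereal by (rule sup_conv_least) (rule assms, simp)

lemma tau_inf_lower:
  assumes "F \<in> Delta_plus" "G \<in> Delta_plus" "s + t = x"
  shows "tau_inf (dual_conorm T) F G (ereal x) \<le> dual_conorm T (F (ereal s)) (G (ereal t))"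
  using sup_conv_upper[OF Delta_plus_funcset(2)[OF assms(1)] Delta_plus_funcset(2)[OF assms(2)], of s x]
    assms(3) by (auto simp: tau_inf_ereal assms(1,2) dual_conorm_def)

lemma tau_inf_greatest:
  assumes "F \<in> Delta_plus" "G \<in> Delta_plus"
    "\<And>s t. s + t = x \<Longrightarrow> c \<le> dual_conorm T (F (ereal s)) (G (ereal t))"
  shows "c \<le> tau_inf (dual_conorm T) F G (ereal x)"
proof -
  have "sup_conv T (\<lambda>s. 1 - F (ereal s)) (\<lambda>s. 1 - G (ereal s)) x \<le> 1 - c"
    by (rule sup_conv_least) (use assms(3)[of s "x - s" for s] in \<open>simp add: dual_conorm_def algebra_simps\<close>)
  then show ?thesis by (simp add: tau_inf_ereal assms)
qed

lemma tau_sup_closed: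
  assumes F: "F \<in> Delta_plus" and G: "G \<in> Delta_plus"
  shows "tau_sup T F G \<in> Delta_plus"
proof (rule Delta_plusI)
  note rg = Delta_plus_range[OF F] Delta_plus_range[OF G]
  show rg': "tau_sup T F G (ereal x) \<in> {0..1}" for x
    unfolding tau_sup_ereal
    by (rule funcset_mem[OF sup_conv_range UNIV_I]) (intro Delta_plus_funcset F G)+
  have "tau_sup T F G (ereal 0) \<le> 0"
  proof (rule tau_sup_least)
    fix s t :: real assume "s + t = 0"
    \<comment> \<open>At the nonpositive summand the distribution function vanishes, and 0
      annihilates T.\<close>
    then have "s \<le> 0 \<or> t \<le> 0" by linarith
    then show "T (F (ereal s)) (G (ereal t)) \<le> 0"
      using Delta_plus_nonpos[OF F, of "ereal s"] Delta_plus_nonpos[OF G, of "ereal t"]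
        zero_left[OF rg(2)] zero_right[OF rg(1)] by auto
  qed
  with rg'[of 0] show "tau_sup T F G 0 = 0" by (simp add: zero_ereal_def)
  show "tau_sup T F G (ereal x) \<le> tau_sup T F G (ereal y)" if "x \<le> y" for x y
  proof (rule tau_sup_least)
    fix s t assume "s + t = x"
    have "T (F (ereal s)) (G (ereal t)) \<le> T (F (ereal s)) (G (ereal (y - s)))"
      using that \<open>s + t = x\<close> by (intro mono rg Delta_plus_mono[OF G]) auto
    also have "\<dots> \<le> tau_sup T F G (ereal y)"
      by (rule tau_sup_upper[OF F G]) simp
    finally show "T (F (ereal s)) (G (ereal t)) \<le> tau_sup T F G (ereal y)" .
  qed
  show "\<exists>y<x. a < tau_sup T F G (ereal y)" if a: "a < tau_sup T F G (ereal x)" for x a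
  proof -
    obtain s where s: "a < T (F (ereal s)) (G (ereal (x - s)))"
      using a less_sup_conv[OF Delta_plus_funcset(1)[OF F] Delta_plus_funcset(1)[OF G]]
      by (auto simp: tau_sup_ereal)
    obtain c d where c: "c < F (ereal s)" "d < G (ereal (x - s))"
      "\<And>x' y'. x' \<in> {0..1} \<Longrightarrow> y' \<in> {0..1} \<Longrightarrow> c < x' \<Longrightarrow> d < y' \<Longrightarrow> a < T x' y'"
      using lower_semicont[OF rg s] by blast
    \<comment> \<open>Moving only s to the left lowers the total below x by the same amount.\<close>
    obtain s' where s': "s' < s" "c < F (ereal s')"
      using Delta_plus_left[OF F c(1)] by blast
    have "a < T (F (ereal s')) (G (ereal (x - s)))" by (intro c s' rg)
    also have "\<dots> \<le> tau_sup T F G (ereal (s' + (x - s)))" by (rule tau_sup_upper[OF F G]) simp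
    finally show ?thesis using s' by (intro exI[of _ "s' + (x - s)"]) auto
  qed
qed simp_all

text \<open>Clamping s to the interval from 0 to y increases neither factor: a summand raised to 0
  has value 0 there, and the other summand is lowered. This confines near-minimizers to a compact
  set for \<open>tau_inf_closed\<close>.\<close>

lemma tau_inf_lt_clamp:
  assumes F: "F \<in> Delta_plus" and G: "G \<in> Delta_plus" and y: "0 \<le> y"
    and less: "tau_inf (dual_conorm T) F G (ereal y) < a"
  obtains s where "0 \<le> s" "s \<le> y" "dual_conorm T (F (ereal s)) (G (ereal (y - s))) < a"
proof -
  obtain s t where s: "s + t = y" "dual_conorm T (F (ereal s)) (G (ereal t)) < a"
    using tau_inf_greatest[OF F G, of y a] less by (meson not_less)
  define r where "r = max 0 (min s y)"
  have "F (ereal r) \<le> F (ereal s)"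
  proof (cases "s \<le> 0")
    case True
    then have "r = 0" using y by (simp add: r_def)
    then show ?thesis using Delta_plus_nonpos[OF F, of 0] Delta_plus_range[OF F, of "ereal s"]
      by (simp add: zero_ereal_def)
  qed (auto simp: r_def intro!: Delta_plus_mono[OF F])
  moreover have "G (ereal (y - r)) \<le> G (ereal t)"
  proof (cases "t \<le> 0")
    case True
    then have "y - r = 0" using y s(1) by (auto simp: r_def)
    then show ?thesis using Delta_plus_nonpos[OF G, of 0] Delta_plus_range[OF G, of "ereal t"]
      by (simp add: zero_ereal_def)
  qed (use s(1) in \<open>auto simp: r_def intro!: Delta_plus_mono[OF G]\<close>)
  ultimately have "dual_conorm T (F (ereal r)) (G (ereal (y - r)))
      \<le> dual_conorm T (F (ereal s)) (G (ereal t))"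
    by (intro conorm_mono Delta_plus_range F G)
  with s(2) that[of r] y show thesis by (simp add: r_def)
qed

text \<open>The delicate point is left continuity, since infima do not preserve it in general. If it
  failed at x, near-minimizers at points increasing to x would accumulate at some l, and lower
  semicontinuity of the conorm at the decomposition l + (x - l) would contradict their small
  values.\<close>

lemma tau_inf_closed:
  assumes F: "F \<in> Delta_plus" and G: "G \<in> Delta_plus"
  shows "tau_inf (dual_conorm T) F G \<in> Delta_plus"
proof (rule Delta_plusI)
  note rg = Delta_plus_range[OF F] Delta_plus_range[OF G]
  show rg': "tau_inf (dual_conorm T) F G (ereal x) \<in> {0..1}" for x
    using funcset_mem[OF sup_conv_range[OF Delta_plus_funcset(2)[OF F] Delta_plus_funcset(2)[OF G]] UNIV_I, of x]
    by (simp add: tau_inf_ereal F G)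
  have "tau_inf (dual_conorm T) F G (ereal 0) \<le> dual_conorm T (F (ereal 0)) (G (ereal 0))"
    by (rule tau_inf_lower[OF F G]) simp
  also have "\<dots> = 0"
    using Delta_plus_nonpos[OF F, of 0] Delta_plus_nonpos[OF G, of 0] conorm_zero_right[of 0]
    by (simp add: zero_ereal_def)
  finally have z: "tau_inf (dual_conorm T) F G (ereal 0) = 0" using rg'[of 0] by simp
  then show "tau_inf (dual_conorm T) F G 0 = 0" by (simp add: zero_ereal_def)
  show mono': "tau_inf (dual_conorm T) F G (ereal x) \<le> tau_inf (dual_conorm T) F G (ereal y)"
    if "x \<le> y" for x y
  proof (rule tau_inf_greatest[OF F G])
    fix s t assume "s + t = y"
    have "tau_inf (dual_conorm T) F G (ereal x) \<le> dual_conorm T (F (ereal s)) (G (ereal (x - s)))"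
      by (rule tau_inf_lower[OF F G]) simp
    also have "\<dots> \<le> dual_conorm T (F (ereal s)) (G (ereal t))"
      using that \<open>s + t = y\<close> by (intro conorm_mono rg Delta_plus_mono[OF G]) auto
    finally show "tau_inf (dual_conorm T) F G (ereal x) \<le> dual_conorm T (F (ereal s)) (G (ereal t))" .
  qed
  show "\<exists>y<x. a < tau_inf (dual_conorm T) F G (ereal y)"
    if a: "a < tau_inf (dual_conorm T) F G (ereal x)" for x a
  proof (rule ccontr)
    assume neg: "\<not> ?thesis"
    have le: "tau_inf (dual_conorm T) F G (ereal y) \<le> a" if "y < x" for y
      using neg that not_less by blast
    \<comment> \<open>Nonnegativity of the values to the left of x forces a to be nonnegative. As
      the infimum vanishes at 0, x must be positive.\<close>
    have "0 \<le> a" using le[of "x - 1"] rg'[of "x - 1"] by auto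
    then have x: "x > 0" using a z mono'[of x 0] by (cases "x > 0") auto
    obtain a' where a': "a < a'" "a' < tau_inf (dual_conorm T) F G (ereal x)"
      using dense[OF a] by blast
    \<comment> \<open>The sequence starts at 0 and increases to x, so every term is admissible for
      \<open>tau_inf_lt_clamp\<close>.\<close>
    define y where "y n = x - x * inverse (real (Suc n))" for n
    have y: "0 \<le> y n" "y n < x" for n
      using x by (auto simp: y_def field_simps)
    have "(\<lambda>n. x - x * inverse (real (Suc n))) \<longlonglongrightarrow> x - x * 0"
      by (intro tendsto_intros LIMSEQ_inverse_real_of_nat)
    then have y_lim: "y \<longlonglongrightarrow> x" by (simp add: y_def[abs_def])
    have "\<exists>s. 0 \<le> s \<and> s \<le> y n \<and> dual_conorm T (F (ereal s)) (G (ereal (y n - s))) < a'" for n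
      using tau_inf_lt_clamp[OF F G y(1)[of n] le_less_trans[OF le[OF y(2)[of n]] a'(1)]] by blast
    then obtain s where s: "\<And>n. 0 \<le> s n" "\<And>n. s n \<le> y n"
      "\<And>n. dual_conorm T (F (ereal (s n))) (G (ereal (y n - s n))) < a'" by metis
    have "\<forall>n. s n \<in> {0..x}" using s(1) order_trans[OF s(2) less_imp_le[OF y(2)]] by simp
    then obtain l r where l: "l \<in> {0..x}" and r: "strict_mono r" and lim: "(s \<circ> r) \<longlonglongrightarrow> l"
      using compact_imp_seq_compact[OF compact_Icc[of 0 x]] unfolding seq_compact_def by metis
    have "a' < dual_conorm T (F (ereal l)) (G (ereal (x - l)))"
      using tau_inf_lower[OF F G, of l "x - l" x] a'(2) by simp
    then obtain c d where c: "c < F (ereal l)" "d < G (ereal (x - l))"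
      "\<And>x' y'. x' \<in> {0..1} \<Longrightarrow> y' \<in> {0..1} \<Longrightarrow> c < x' \<Longrightarrow> d < y' \<Longrightarrow> a' < dual_conorm T x' y'"
      using conorm_lower_semicont[OF rg] by metis
    \<comment> \<open>Points strictly left of l and x - l are eventually passed by the convergent
      summands, so monotonicity transfers the bounds c and d to them although F and G may
      jump.\<close>
    obtain l' where l': "l' < l" "c < F (ereal l')" using Delta_plus_left[OF F c(1)] by blast
    obtain t' where t': "t' < x - l" "d < G (ereal t')" using Delta_plus_left[OF G c(2)] by blast
    have "(\<lambda>n. y (r n) - s (r n)) \<longlonglongrightarrow> x - l"
      using LIMSEQ_subseq_LIMSEQ[OF y_lim r] lim by (auto simp: o_def intro: tendsto_diff)
    then have "\<forall>\<^sub>F n in sequentially. t' < y (r n) - s (r n)" using t' by (auto intro: order_tendstoD)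
    moreover have "\<forall>\<^sub>F n in sequentially. l' < s (r n)"
      using order_tendstoD(1)[OF lim l'(1)] by simp
    ultimately have "\<forall>\<^sub>F n in sequentially. False"
    proof eventually_elim
      case (elim n)
      have "F (ereal l') \<le> F (ereal (s (r n)))" "G (ereal t') \<le> G (ereal (y (r n) - s (r n)))"
        using elim by (auto intro!: Delta_plus_mono F G)
      then have "a' < dual_conorm T (F (ereal (s (r n)))) (G (ereal (y (r n) - s (r n))))"
        using l' t' by (intro c(3) rg) auto
      with s(3)[of "r n"] show False by simp
    qed
    then show False by simp
  qed
qed simp_all

section \<open>Triangle function laws and comparison of the two operations\<close>

lemma tau_sup_triangle_function: "triangle_function (tau_sup T)"
  unfolding triangle_function_def
proof (intro conjI ballI impI)
  fix F assume F: "F \<in> Delta_plus"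
  show "tau_sup T F eps0 = F"
  proof (rule ereal_fun_eqI)
    fix x
    have "tau_sup T F eps0 (ereal x) \<le> F (ereal x)"
    proof (rule tau_sup_least)
      fix s t :: real assume st: "s + t = x"
      show "T (F (ereal s)) (eps0 (ereal t)) \<le> F (ereal x)"
      proof (cases "t \<le> 0")
        case True
        then show ?thesis
          using zero_right[OF Delta_plus_range[OF F]] Delta_plus_range[OF F] by (simp add: eps0_def)
      next
        case False
        then show ?thesis
          using one_right[OF Delta_plus_range[OF F]] Delta_plus_mono[OF F, of "ereal s" "ereal x"] st
          by (simp add: eps0_def)
      qed
    qed
    \<comment> \<open>The factor \<open>eps0\<close> equals 1 at x - s only when s < x, so the value
      F x is recovered through left continuity.\<close>
    moreover have "\<not> tau_sup T F eps0 (ereal x) < F (ereal x)"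
    proof
      assume "tau_sup T F eps0 (ereal x) < F (ereal x)"
      then obtain s where s: "s < x" "tau_sup T F eps0 (ereal x) < F (ereal s)"
        using Delta_plus_left[OF F] by blast
      with tau_sup_upper[OF F eps0_Delta_plus, of s "x - s" x] show False
        using one_right[OF Delta_plus_range[OF F]] by (simp add: eps0_def)
    qed
    ultimately show "tau_sup T F eps0 (ereal x) = F (ereal x)" by simp
  qed (use Delta_plus_infinity[OF F] in simp_all)
next
  fix F G assume F: "F \<in> Delta_plus" and G: "G \<in> Delta_plus"
  show "tau_sup T F G \<in> Delta_plus" by (rule tau_sup_closed[OF F G])
  show "tau_sup T F G = tau_sup T G F"
    using sup_conv_commute[OF Delta_plus_funcset(1)[OF F] Delta_plus_funcset(1)[OF G]]
    by (intro ereal_fun_eqI) (simp_all add: tau_sup_ereal)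
  fix H assume H: "H \<in> Delta_plus"
  show "tau_sup T (tau_sup T F G) H = tau_sup T F (tau_sup T G H)"
    using sup_conv_assoc[OF Delta_plus_funcset(1)[OF F] Delta_plus_funcset(1)[OF G] Delta_plus_funcset(1)[OF H]]
    by (intro ereal_fun_eqI) (simp_all add: tau_sup_ereal)
next
  fix F F' G G' assume *: "F \<in> Delta_plus" "F' \<in> Delta_plus" "G \<in> Delta_plus" "G' \<in> Delta_plus"
    and le: "F \<le> F' \<and> G \<le> G'"
  show "tau_sup T F G \<le> tau_sup T F' G'"
    using le by (intro ereal_fun_leI)
      (auto simp: tau_sup_ereal le_fun_def intro!: sup_conv_mono Delta_plus_range *)
qed

lemma tau_inf_triangle_function: "triangle_function (tau_inf (dual_conorm T))"
  unfolding triangle_function_def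
proof (intro conjI ballI impI)
  fix F assume F: "F \<in> Delta_plus"
  note rg = Delta_plus_range[OF F] Delta_plus_range[OF eps0_Delta_plus]
  show "tau_inf (dual_conorm T) F eps0 = F"
  proof (rule ereal_fun_eqI, rule_tac [3] antisym)
    fix x
    show "tau_inf (dual_conorm T) F eps0 (ereal x) \<le> F (ereal x)"
      using tau_inf_lower[OF F eps0_Delta_plus, of x 0 x] conorm_zero_right[OF rg(1)]
      by (simp add: eps0_def)
    show "F (ereal x) \<le> tau_inf (dual_conorm T) F eps0 (ereal x)"
    proof (rule tau_inf_greatest[OF F eps0_Delta_plus])
      fix s t :: real assume st: "s + t = x"
      show "F (ereal x) \<le> dual_conorm T (F (ereal s)) (eps0 (ereal t))"
      \<comment> \<open>For t \<le> 0 the other summand satisfies s \<ge> x. For t > 0 the value 1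
        of \<open>eps0\<close> makes the conorm at least 1.\<close>
      proof (cases "t \<le> 0")
        case True
        then show ?thesis
          using st Delta_plus_mono[OF F, of "ereal x" "ereal s"] conorm_ge_left[OF rg]
          by (force intro: order_trans)
      next
        case False
        then show ?thesis
          using conorm_ge_right[OF rg, of "ereal t" "ereal s"] rg(1)[of "ereal x"]
          by (simp add: eps0_def)
      qed
    qed
  qed (use Delta_plus_infinity[OF F] in simp_all)
next
  fix F G assume F: "F \<in> Delta_plus" and G: "G \<in> Delta_plus"
  show "tau_inf (dual_conorm T) F G \<in> Delta_plus" by (rule tau_inf_closed[OF F G])
  show "tau_inf (dual_conorm T) F G = tau_inf (dual_conorm T) G F"
    using sup_conv_commute[OF Delta_plus_funcset(2)[OF F] Delta_plus_funcset(2)[OF G]]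
    by (intro ereal_fun_eqI) (simp_all add: tau_inf_ereal F G)
  fix H assume H: "H \<in> Delta_plus"
  show "tau_inf (dual_conorm T) (tau_inf (dual_conorm T) F G) H
      = tau_inf (dual_conorm T) F (tau_inf (dual_conorm T) G H)"
    using sup_conv_assoc[OF Delta_plus_funcset(2)[OF F] Delta_plus_funcset(2)[OF G] Delta_plus_funcset(2)[OF H]]
    by (intro ereal_fun_eqI) (simp_all add: tau_inf_ereal F G H tau_inf_closed)
next
  fix F F' G G' assume *: "F \<in> Delta_plus" "F' \<in> Delta_plus" "G \<in> Delta_plus" "G' \<in> Delta_plus"
    and le: "F \<le> F' \<and> G \<le> G'"
  show "tau_inf (dual_conorm T) F G \<le> tau_inf (dual_conorm T) F' G'"
    using le by (intro ereal_fun_leI)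
      (auto simp: tau_inf_ereal le_fun_def * intro!: sup_conv_mono Delta_plus_funcset(2) *)
qed

text \<open>Given two decompositions of the same x, either s \<le> s' or t \<le> t'. Comparing just
  that coordinate is enough, because T lies below each of its arguments and the conorm above each of
  its own.\<close>

lemma tau_sup_le_tau_inf:
  assumes F: "F \<in> Delta_plus" and G: "G \<in> Delta_plus"
  shows "tau_sup T F G \<le> tau_inf (dual_conorm T) F G"
proof (rule ereal_fun_leI)
  note rg = Delta_plus_range[OF F] Delta_plus_range[OF G]
  fix x
  show "tau_sup T F G (ereal x) \<le> tau_inf (dual_conorm T) F G (ereal x)"
  proof (intro tau_sup_least tau_inf_greatest F G)
    fix s t s' t' :: real assume "s + t = x" "s' + t' = x"
    then consider "s \<le> s'" | "t \<le> t'" by linarith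
    then show "T (F (ereal s)) (G (ereal t)) \<le> dual_conorm T (F (ereal s')) (G (ereal t'))"
    proof cases
      case 1
      then have "F (ereal s) \<le> F (ereal s')" by (intro Delta_plus_mono[OF F]) simp
      then show ?thesis using le_left[OF rg, of "ereal s" "ereal t"]
          conorm_ge_left[OF rg, of "ereal s'" "ereal t'"] by linarith
    next
      case 2
      then have "G (ereal t) \<le> G (ereal t')" by (intro Delta_plus_mono[OF G]) simp
      then show ?thesis using le_right[OF rg, of "ereal s" "ereal t"]
          conorm_ge_right[OF rg, of "ereal t'" "ereal s'"] by linarith
    qed
  qed
qed simp_all

section \<open>Uniform continuity with respect to the Levy-type entourages\<close>

lemma tau_sup_modulus:
  assumes \<delta>: "0 < \<delta>"
  shows "\<exists>\<eta>>0. \<forall>F\<in>Delta_plus. \<forall>F'\<in>Delta_plus. \<forall>G\<in>Delta_plus. \<forall>G'\<in>Delta_plus.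
      below_upto \<eta> F F' \<longrightarrow> below_upto \<eta> G G' \<longrightarrow> below_upto \<delta> (tau_sup T F G) (tau_sup T F' G')"
proof -
  obtain \<eta>' where \<eta>': "0 < \<eta>'"
    "\<And>x x' y y'. x \<in> {0..1} \<Longrightarrow> x' \<in> {0..1} \<Longrightarrow> y \<in> {0..1} \<Longrightarrow> y' \<in> {0..1} \<Longrightarrow>
      x \<le> x' + \<eta>' \<Longrightarrow> y \<le> y' + \<eta>' \<Longrightarrow> T x y \<le> T x' y' + \<delta>"
    using modulus[OF \<delta>] by blast
  \<comment> \<open>Each of the two summands is shifted by \<eta>, so the total shift is at most
    \<delta>.\<close>
  define \<eta> where "\<eta> = min \<eta>' (\<delta> / 2)"
  have \<eta>: "0 < \<eta>" "\<eta> \<le> \<eta>'" "\<eta> \<le> \<delta> / 2" using \<eta>' \<delta> by (auto simp: \<eta>_def)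
  have "below_upto \<delta> (tau_sup T F G) (tau_sup T F' G')"
    if D: "F \<in> Delta_plus" "F' \<in> Delta_plus" "G \<in> Delta_plus" "G' \<in> Delta_plus"
      and bF: "below_upto \<eta> F F'" and bG: "below_upto \<eta> G G'" for F F' G G'
    unfolding below_upto_def
  proof (intro allI impI tau_sup_least)
    note rg = D[THEN Delta_plus_range]
    fix x s t assume x: "\<delta> * x \<le> 1" and st: "s + t = x"
    show "T (F (ereal s)) (G (ereal t)) \<le> tau_sup T F' G' (ereal (x + \<delta>)) + \<delta>"
    proof (cases "s \<le> 0 \<or> t \<le> 0")
      case True
      then have "T (F (ereal s)) (G (ereal t)) = 0"
        using Delta_plus_nonpos[OF D(1), of "ereal s"] Delta_plus_nonpos[OF D(3), of "ereal t"]
          zero_left[OF rg(3)] zero_right[OF rg(1)] by auto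
      then show ?thesis
        using Delta_plus_range[OF tau_sup_closed[OF D(2,4)], of "ereal (x + \<delta>)"] \<delta> by simp
    next
      case False
      \<comment> \<open>Both summands are positive here, hence at most x, and the cutoff condition
        at x covers them.\<close>
      then have "\<eta> * s \<le> \<delta> * x" "\<eta> * t \<le> \<delta> * x"
        using st \<eta> \<delta> by (auto intro!: mult_mono)
      then have "F (ereal s) \<le> F' (ereal (s + \<eta>)) + \<eta>" "G (ereal t) \<le> G' (ereal (t + \<eta>)) + \<eta>"
        using bF bG x by (auto simp: below_upto_def)
      then have "T (F (ereal s)) (G (ereal t)) \<le> T (F' (ereal (s + \<eta>))) (G' (ereal (t + \<eta>))) + \<delta>"
        using \<eta> by (intro \<eta>'(2) rg) auto
      also have "\<dots> \<le> tau_sup T F' G' (ereal (x + 2 * \<eta>)) + \<delta>"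
        using tau_sup_upper[OF D(2,4), of "s + \<eta>" "t + \<eta>" "x + 2 * \<eta>"] st by simp
      also have "\<dots> \<le> tau_sup T F' G' (ereal (x + \<delta>)) + \<delta>"
        using Delta_plus_mono[OF tau_sup_closed[OF D(2,4)], of "ereal (x + 2 * \<eta>)" "ereal (x + \<delta>)"]
          \<eta>(3) by simp
      finally show ?thesis .
    qed
  qed
  with \<eta>(1) show ?thesis by blast
qed

lemma tau_inf_modulus:
  assumes \<delta>: "0 < \<delta>"
  shows "\<exists>\<eta>>0. \<forall>F\<in>Delta_plus. \<forall>F'\<in>Delta_plus. \<forall>G\<in>Delta_plus. \<forall>G'\<in>Delta_plus.
      below_upto \<eta> F F' \<longrightarrow> below_upto \<eta> G G' \<longrightarrow>
      below_upto \<delta> (tau_inf (dual_conorm T) F G) (tau_inf (dual_conorm T) F' G')"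
proof -
  obtain \<eta>' where \<eta>': "0 < \<eta>'"
    "\<And>x x' y y'. x \<in> {0..1} \<Longrightarrow> x' \<in> {0..1} \<Longrightarrow> y \<in> {0..1} \<Longrightarrow> y' \<in> {0..1} \<Longrightarrow>
      x \<le> x' + \<eta>' \<Longrightarrow> y \<le> y' + \<eta>' \<Longrightarrow> dual_conorm T x y \<le> dual_conorm T x' y' + \<delta>"
    using conorm_modulus[OF \<delta>] by blast
  define \<eta> where "\<eta> = Min {\<eta>', \<delta> / 2, 1 / 2}"
  have \<eta>: "0 < \<eta>" "\<eta> \<le> \<eta>'" "\<eta> \<le> \<delta> / 2" "\<eta> \<le> 1 / 2" using \<eta>' \<delta> by (auto simp: \<eta>_def)
  have "below_upto \<delta> (tau_inf (dual_conorm T) F G) (tau_inf (dual_conorm T) F' G')"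
    if D: "F \<in> Delta_plus" "F' \<in> Delta_plus" "G \<in> Delta_plus" "G' \<in> Delta_plus"
      and bF: "below_upto \<eta> F F'" and bG: "below_upto \<eta> G G'" for F F' G G'
    unfolding below_upto_def
  proof (intro allI impI)
    note rg = D[THEN Delta_plus_range]
    note le = tau_inf_lower[OF D(1,3)]
    fix x assume x: "\<delta> * x \<le> 1"
    show "tau_inf (dual_conorm T) F G (ereal x) \<le> tau_inf (dual_conorm T) F' G' (ereal (x + \<delta>)) + \<delta>"
    proof (cases "x \<le> 0")
      case True
      then show ?thesis
        using Delta_plus_nonpos[OF tau_inf_closed[OF D(1,3)], of "ereal x"]
          Delta_plus_range[OF tau_inf_closed[OF D(2,4)], of "ereal (x + \<delta>)"] \<delta> by simp
    next
      case False
      \<comment> \<open>The bounds \<eta> \<le> \<delta>/2 and \<eta> \<le> 1/2 make both \<eta> x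
        and \<eta> \<eta> at most 1/2, so arguments up to x + \<eta> respect the cutoff.\<close>
      have cut: "\<eta> * z \<le> 1" if "z \<le> x + \<eta>" for z
      proof -
        have "\<eta> * z \<le> \<eta> * x + \<eta> * \<eta>" using that \<eta> by (simp add: distrib_left[symmetric])
        also have "\<eta> * x \<le> \<delta> / 2 * x" using \<eta> False by (intro mult_right_mono) auto
        also have "\<eta> * \<eta> \<le> 1 / 2 * 1" using \<eta> by (intro mult_mono) auto
        finally show ?thesis using x by simp
      qed
      have "tau_inf (dual_conorm T) F G (ereal x) - \<delta> \<le> tau_inf (dual_conorm T) F' G' (ereal (x + 2 * \<eta>))"
      proof (rule tau_inf_greatest[OF D(2,4)])
        fix s t assume st: "s + t = x + 2 * \<eta>"
        \<comment> \<open>Unlike in the supremal case, a summand may lie beyond the cutoff. If it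
          exceeds x + \<eta>, its factor alone dominates: taking 0 as the other summand bounds the
          infimum at x by F x or G x.\<close>
        consider "s - \<eta> \<le> x" "t - \<eta> \<le> x" | "x < s - \<eta>" | "x < t - \<eta>" by linarith
        then show "tau_inf (dual_conorm T) F G (ereal x) - \<delta>
            \<le> dual_conorm T (F' (ereal s)) (G' (ereal t))"
        proof cases
          case 1
          then have "F (ereal (s - \<eta>)) \<le> F' (ereal (s - \<eta> + \<eta>)) + \<eta>"
            "G (ereal (t - \<eta>)) \<le> G' (ereal (t - \<eta> + \<eta>)) + \<eta>"
            using bF bG cut[of "s - \<eta>"] cut[of "t - \<eta>"] \<eta> by (auto simp only: below_upto_def)
          then have "dual_conorm T (F (ereal (s - \<eta>))) (G (ereal (t - \<eta>)))
              \<le> dual_conorm T (F' (ereal s)) (G' (ereal t)) + \<delta>"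
            using \<eta> by (intro \<eta>'(2) rg) auto
          then show ?thesis using le[of "s - \<eta>" "t - \<eta>" x] st by simp
        next
          case 2
          have "tau_inf (dual_conorm T) F G (ereal x) \<le> F (ereal x)"
            using le[of x 0 x] Delta_plus_nonpos[OF D(3), of 0] conorm_zero_right[OF rg(1)]
            by (simp add: zero_ereal_def)
          also have "\<dots> \<le> F' (ereal (x + \<eta>)) + \<eta>"
            using bF cut[of x] \<eta> by (simp add: below_upto_def)
          also have "F' (ereal (x + \<eta>)) \<le> F' (ereal s)"
            using 2 by (intro Delta_plus_mono D) simp
          also have "\<dots> \<le> dual_conorm T (F' (ereal s)) (G' (ereal t))" by (intro conorm_ge_left rg)
          finally show ?thesis using \<eta> \<delta> by simp
        next
          case 3
          have "tau_inf (dual_conorm T) F G (ereal x) \<le> G (ereal x)"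
            using le[of 0 x x] Delta_plus_nonpos[OF D(1), of 0] conorm_zero_left[OF rg(3)]
            by (simp add: zero_ereal_def)
          also have "\<dots> \<le> G' (ereal (x + \<eta>)) + \<eta>"
            using bG cut[of x] \<eta> by (simp add: below_upto_def)
          also have "G' (ereal (x + \<eta>)) \<le> G' (ereal t)"
            using 3 by (intro Delta_plus_mono D) simp
          also have "\<dots> \<le> dual_conorm T (F' (ereal s)) (G' (ereal t))" by (intro conorm_ge_right rg)
          finally show ?thesis using \<eta> \<delta> by simp
        qed
      qed
      also have "\<dots> \<le> tau_inf (dual_conorm T) F' G' (ereal (x + \<delta>))"
        using \<eta>(3) by (intro Delta_plus_mono tau_inf_closed D) simp
      finally show ?thesis by simp
    qed
  qed
  with \<eta>(1) show ?thesis by blast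
qed

lemma continuous_triangle_tau_sup: "continuous_triangle_function (tau_sup T)"
  unfolding continuous_triangle_function_def
  by (intro conjI tau_sup_triangle_function continuous_map_weak_topologyI tau_sup_closed
      tau_sup_modulus)

lemma continuous_triangle_tau_inf: "continuous_triangle_function (tau_inf (dual_conorm T))"
  unfolding continuous_triangle_function_def
  by (intro conjI tau_inf_triangle_function continuous_map_weak_topologyI tau_inf_closed
      tau_inf_modulus)

end

section \<open>The strong topology\<close>

lemma is_tvs_euclidean: "is_tvs (euclidean :: 'v::real_normed_vector topology)"
  unfolding is_tvs_def by (auto simp: case_prod_unfold intro!: continuous_intros)

lemma topologically_bounded_euclidean:
  fixes A :: "'v::real_normed_vector set"
  assumes "bounded A"
  shows "topologically_bounded euclidean A"
  unfolding topologically_bounded_def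
proof (intro allI impI)
  fix \<alpha> :: "nat \<Rightarrow> real" and p :: "nat \<Rightarrow> 'v"
  assume *: "\<alpha> \<longlonglongrightarrow> 0 \<and> (\<forall>n. p n \<in> A)"
  obtain C where C: "\<And>x. x \<in> A \<Longrightarrow> norm x \<le> C" using assms by (auto simp: bounded_iff)
  have "(\<lambda>n. \<bar>\<alpha> n\<bar> * C) \<longlonglongrightarrow> \<bar>0\<bar> * C" using * by (intro tendsto_intros) auto
  then have "(\<lambda>n. \<bar>\<alpha> n\<bar> * C) \<longlonglongrightarrow> 0" by simp
  then have "(\<lambda>n. \<alpha> n *\<^sub>R p n) \<longlonglongrightarrow> 0"
    by (rule Lim_null_comparison[rotated]) (use * C in \<open>auto intro!: always_eventually mult_left_mono\<close>)
  then show "limitin euclidean (\<lambda>n. \<alpha> n *\<^sub>R p n) 0 sequentially" by simp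
qed

text \<open>The assumption \<open>nontrivial\<close> excludes the zero space. There
  \<open>\<nu> 0 = eps0\<close> lies in \<open>D_plus\<close>, so the only point forms a
  \<D>-bounded neighbourhood and the space is both Serstnev and characteristic.\<close>

theorem theorem9:
  fixes T :: "real \<Rightarrow> real \<Rightarrow> real"
    and f :: "real \<Rightarrow> real"
    and \<nu> :: "'v::real_normed_vector \<Rightarrow> ereal \<Rightarrow> real"
  assumes nontrivial: "(UNIV :: 'v set) \<noteq> {0}"
    and T: "continuous_tnorm T"
    and f_range: "\<And>x. x \<ge> 0 \<Longrightarrow> f x \<in> {0..1}"
    and f_right_cont: "\<And>x. x \<ge> 0 \<Longrightarrow> continuous (at_right x) f"
    and f_noninc: "antimono_on {0..} f"
    and a: "\<And>x. x \<ge> 0 \<Longrightarrow> f x = 1 \<longleftrightarrow> x = 0"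
    and b: "\<And>p q :: 'v. f (norm (p + q)) \<ge> T (f (norm p)) (f (norm q))"
    and \<nu>_nonpos: "\<And>p x. x \<le> 0 \<Longrightarrow> \<nu> p x = 0"
    and \<nu>_pos: "\<And>p x. 0 < x \<Longrightarrow> x < \<infinity> \<Longrightarrow> \<nu> p x = f (norm p)"
    and \<nu>_inf: "\<And>p. \<nu> p \<infinity> = 1"
  shows "menger_pn_space \<nu> (tau_sup T) (tau_inf (dual_conorm T))
    \<and> is_tvs (strong_topology \<nu>)
    \<and> normable \<nu>
    \<and> (\<forall>p. \<forall>t>0. \<not> D_bounded \<nu> (strong_nbhd \<nu> p t)
        \<and> (strong_nbhd \<nu> p t \<noteq> UNIV
            \<longrightarrow> topologically_bounded (strong_topology \<nu>) (strong_nbhd \<nu> p t)))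
    \<and> \<not> serstnev_space \<nu> (tau_sup T)
    \<and> \<not> characteristic_pn \<nu>"
proof -
  interpret cont_tnorm T by unfold_locales (rule T)
  have anti: "f y \<le> f x" if "0 \<le> x" "x \<le> y" for x y
    using monotone_onD[OF f_noninc, of x y] that by auto
  have f0: "f 0 = 1" using a[of 0] by simp
  have f_less_1: "f (norm p) < 1" if "p \<noteq> 0" for p :: 'v
    using a[of "norm p"] f_range[of "norm p"] that by auto
  \<comment> \<open>Right continuity enters in this form twice: at a distance, to make strong
    neighbourhoods open, and at 0, to refute the Serstnev identity.\<close>
  have f_right: "\<exists>y>x. \<forall>z. x < z \<and> z < y \<longrightarrow> c < f z" if "0 \<le> x" "c < f x" for x c
  proof -
    have "\<forall>\<^sub>F z in at_right x. c < f z"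
      using f_right_cont[OF that(1)] that(2) by (auto simp: continuous_within intro: order_tendstoD)
    then show ?thesis by (auto simp: eventually_at_right_field)
  qed
  have \<nu>: "\<nu> p (ereal x) = (if x \<le> 0 then 0 else f (norm p))" for p x
    using \<nu>_nonpos[of "ereal x" p] \<nu>_pos[of "ereal x" p] by auto
  have \<nu>_minf: "\<nu> p (-\<infinity>) = 0" for p by (simp add: \<nu>_nonpos)
  obtain p\<^sub>0 :: 'v where p\<^sub>0: "p\<^sub>0 \<noteq> 0" using nontrivial by blast

  \<comment> \<open>The Menger PN space axioms\<close>
  have \<nu>_Delta: "\<nu> p \<in> Delta_plus" for p
  proof (rule Delta_plusI)
    fix x b assume b: "b < \<nu> p (ereal x)"
    \<comment> \<open>Halving a positive x keeps the constant value f (norm p). For x \<le> 0 the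
      bound b is negative and any point further left works.\<close>
    show "\<exists>y<x. b < \<nu> p (ereal y)"
      by (rule exI[of _ "if x \<le> 0 then x - 1 else x / 2"]) (use b in \<open>auto simp: \<nu>\<close>)
  qed (use f_range[of "norm p"] in \<open>auto simp: \<nu> \<nu>_inf \<nu>_minf \<nu>_nonpos\<close>)
  have "PN1 \<nu>" unfolding PN1_def
  proof (intro allI iffI)
    fix p assume "\<nu> p = eps0"
    then have "\<nu> p (ereal 1) = 1" by (simp add: eps0_def)
    then show "p = 0" using f_less_1[of p] by (auto simp: \<nu>)
  next
    fix p :: 'v assume "p = 0"
    then show "\<nu> p = eps0"
      by (intro ereal_fun_eqI) (auto simp: \<nu> \<nu>_inf \<nu>_minf eps0_def f0)
  qed
  have "PN2 \<nu>" unfolding PN2_def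
    by (intro allI ereal_fun_eqI) (auto simp: \<nu> \<nu>_inf \<nu>_minf)
  have "PN3 \<nu> (tau_sup T)" unfolding PN3_def
  proof (intro allI ereal_fun_leI)
    fix p q x
    show "tau_sup T (\<nu> p) (\<nu> q) (ereal x) \<le> \<nu> (p + q) (ereal x)"
    proof (cases "x \<le> 0")
      case True
      then show ?thesis
        using Delta_plus_nonpos[OF tau_sup_closed[OF \<nu>_Delta \<nu>_Delta], of "ereal x"] by (simp add: \<nu>)
    next
      case False
      have "tau_sup T (\<nu> p) (\<nu> q) (ereal x) \<le> T (f (norm p)) (f (norm q))"
        by (rule tau_sup_least) (use f_range[of "norm p"] f_range[of "norm q"] in \<open>auto simp: \<nu> intro!: mono\<close>)
      also have "\<dots> \<le> \<nu> (p + q) (ereal x)" using b[of p q] False by (simp add: \<nu>)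
      finally show ?thesis .
    qed
  qed (simp_all add: \<nu>_inf \<nu>_minf)
  have "PN4 \<nu> (tau_inf (dual_conorm T))" unfolding PN4_def
  proof (intro allI ballI ereal_fun_leI)
    fix p and l x :: real assume l: "l \<in> {0..1}"
    show "\<nu> p (ereal x) \<le> tau_inf (dual_conorm T) (\<nu> (l *\<^sub>R p)) (\<nu> ((1 - l) *\<^sub>R p)) (ereal x)"
    proof (rule tau_inf_greatest[OF \<nu>_Delta \<nu>_Delta])
      fix s t assume st: "s + t = x"
      have contract: "f (norm p) \<le> f (norm (k *\<^sub>R p))" if "k \<in> {0..1}" for k :: real
        using that by (intro anti) (auto simp: mult_left_le_one_le)
      note rg = Delta_plus_range[OF \<nu>_Delta] Delta_plus_range[OF \<nu>_Delta]
      \<comment> \<open>When x > 0 one of the summands is positive. There the factor has its full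
        value, which is at least f (norm p) because scaling by a number in [0,1] does not lengthen
        p.\<close>
      consider "x \<le> 0" | "x > 0" "s > 0" | "x > 0" "t > 0" using st by linarith
      then show "\<nu> p (ereal x) \<le> dual_conorm T (\<nu> (l *\<^sub>R p) (ereal s)) (\<nu> ((1 - l) *\<^sub>R p) (ereal t))"
      proof cases
        case 1
        then show ?thesis using conorm_range[OF rg] by (simp add: \<nu>_nonpos)
      next
        case 2
        then have "\<nu> p (ereal x) \<le> \<nu> (l *\<^sub>R p) (ereal s)"
          using contract[OF l] by (simp add: \<nu>)
        also note conorm_ge_left[OF rg]
        finally show ?thesis .
      next
        case 3
        then have "\<nu> p (ereal x) \<le> \<nu> ((1 - l) *\<^sub>R p) (ereal t)"
          using contract[of "1 - l"] l by (simp add: \<nu>)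
        also note conorm_ge_right[OF rg]
        finally show ?thesis .
      qed
    qed
  qed (simp_all add: \<nu>_inf \<nu>_minf)
  have menger: "menger_pn_space \<nu> (tau_sup T) (tau_inf (dual_conorm T))"
    unfolding menger_pn_space_def pn_space_def
    using continuous_triangle_tau_sup continuous_triangle_tau_inf tau_sup_le_tau_inf \<nu>_Delta T
      \<open>PN1 \<nu>\<close> \<open>PN2 \<nu>\<close> \<open>PN3 \<nu> (tau_sup T)\<close> \<open>PN4 \<nu> (tau_inf (dual_conorm T))\<close>
    by blast

  \<comment> \<open>Strong neighbourhoods and the norm topology\<close>
  have nbhd: "strong_nbhd \<nu> p t = {q. 1 - t < f (dist p q)}" if "t > 0" for p t
    using that by (simp add: strong_nbhd_def \<nu> dist_norm)
  have nbhd_open: "open (strong_nbhd \<nu> p t)" if t: "t > 0" for p t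
    unfolding nbhd[OF t] open_dist
  proof (intro ballI)
    fix q assume "q \<in> {q. 1 - t < f (dist p q)}"
    then obtain y where y: "dist p q < y" "\<And>z. dist p q < z \<Longrightarrow> z < y \<Longrightarrow> 1 - t < f z"
      using f_right[of "dist p q" "1 - t"] by auto
    have "1 - t < f (dist p r)" if "dist r q < y - dist p q" for r
    proof -
      have "dist p r < y" using that dist_triangle[of p r q] by (simp add: dist_commute)
      \<comment> \<open>The bound on f is known only strictly to the right of dist p q, so z is
        taken there and also beyond dist p r. Monotonicity then carries the bound back to dist p
        r.\<close>
      then obtain z where "max (dist p r) (dist p q) < z" "z < y"
        using y(1) dense[of "max (dist p r) (dist p q)" y] by auto
      then show ?thesis using y(2)[of z] anti[of "dist p r" z] by simp
    qed
    then show "\<exists>e>0. \<forall>r. dist r q < e \<longrightarrow> r \<in> {q. 1 - t < f (dist p q)}"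
      using y(1) by (intro exI[of _ "y - dist p q"]) auto
  qed
  have nbhd_small: "\<exists>t>0. p \<in> strong_nbhd \<nu> p t \<and> strong_nbhd \<nu> p t \<subseteq> ball p r" if r: "r > 0" for p r
  proof -
    \<comment> \<open>With this radius, membership means f r < f (dist p q), which by monotonicity
      forces dist p q < r.\<close>
    have t: "1 - f r > 0" using a[of r] f_range[of r] r by auto
    moreover have "strong_nbhd \<nu> p (1 - f r) \<subseteq> ball p r"
    proof
      fix q assume "q \<in> strong_nbhd \<nu> p (1 - f r)"
      then have "f r < f (dist p q)" by (simp add: nbhd[OF t])
      then show "q \<in> ball p r" using anti[of r "dist p q"] r by force
    qed
    ultimately show ?thesis using nbhd[OF t] f0 by (intro exI[of _ "1 - f r"]) auto
  qed
  have top: "strong_topology \<nu> = euclidean"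
    unfolding topology_eq
  proof (intro allI iffI)
    fix U assume "openin (strong_topology \<nu>) U"
    then have "generate_topology_on {strong_nbhd \<nu> p t | p t. t > 0} U"
      by (simp add: strong_topology_def openin_topology_generated_by_iff)
    then have "open U"
      by induction (auto intro: nbhd_open)
    then show "openin euclidean U" by simp
  next
    fix U :: "'v set" assume "openin euclidean U"
    then have "open U" by simp
    have "\<exists>N. openin (strong_topology \<nu>) N \<and> p \<in> N \<and> N \<subseteq> U" if "p \<in> U" for p
    proof -
      obtain r where r: "r > 0" "ball p r \<subseteq> U"
        by (rule openE[OF \<open>open U\<close> \<open>p \<in> U\<close>])
      obtain t where t: "t > 0" "p \<in> strong_nbhd \<nu> p t" "strong_nbhd \<nu> p t \<subseteq> ball p r"
        using nbhd_small[OF r(1)] by blast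
      have "openin (strong_topology \<nu>) (strong_nbhd \<nu> p t)"
        unfolding strong_topology_def by (rule topology_generated_by_Basis) (use t(1) in blast)
      with t r show ?thesis by blast
    qed
    then show "openin (strong_topology \<nu>) U" by (subst openin_subopen) blast
  qed
  have "normable \<nu>"
    unfolding normable_def
  proof (intro exI[of _ norm] conjI)
    show "is_norm (norm :: 'v \<Rightarrow> real)" by (auto simp: is_norm_def norm_triangle_ineq)
    have "(\<lambda>p q :: 'v. norm (p - q)) = dist" by (intro ext) (simp add: dist_norm)
    then show "strong_topology \<nu> = Metric_space.mtopology UNIV (\<lambda>p q. norm (p - q))"
      using top by simp
  qed

  \<comment> \<open>Boundedness, the Serstnev identity and characteristic spaces\<close>
  have not_D_bounded: "\<not> D_bounded \<nu> A" if "q \<in> A" "q \<noteq> 0" for A q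
  proof
    assume "D_bounded \<nu> A"
    then obtain G where G: "G \<in> D_plus" "G \<le> \<nu> q" using \<open>q \<in> A\<close> by (auto simp: D_bounded_def)
    have "\<forall>\<^sub>F x in at_top. f (norm q) < G (ereal x)"
      using G(1) f_less_1[OF \<open>q \<noteq> 0\<close>] by (auto simp: D_plus_def intro: order_tendstoD)
    then obtain N where "\<And>x. N \<le> x \<Longrightarrow> f (norm q) < G (ereal x)"
      unfolding eventually_at_top_linorder by blast
    moreover obtain x where x: "N \<le> x" "0 < x"
      using that[of "max N 1"] by simp
    ultimately have "f (norm q) < G (ereal x)" by blast
    then show False using le_funD[OF G(2), of "ereal x"] x(2) by (simp add: \<nu>)
  qed
  have F3_unbounded: "\<not> D_bounded \<nu> (strong_nbhd \<nu> p t)" if t: "t > 0" for p t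
  proof -
    have "p \<in> strong_nbhd \<nu> p t" using t by (simp add: nbhd f0)
    then obtain e where e: "e > 0" "ball p e \<subseteq> strong_nbhd \<nu> p t"
      by (rule openE[OF nbhd_open[OF t]])
    \<comment> \<open>The displacement has norm e/2, so q is a second point of the ball. Of two
      distinct points at least one is nonzero.\<close>
    define q where "q = p + (e / (2 * norm p\<^sub>0)) *\<^sub>R p\<^sub>0"
    have "p \<in> ball p e" "q \<in> ball p e" "p \<noteq> q"
      using e p\<^sub>0 by (auto simp: q_def dist_norm)
    then have "p \<in> strong_nbhd \<nu> p t" "q \<in> strong_nbhd \<nu> p t" using e(2) by auto
    with not_D_bounded show ?thesis by (cases "p = 0") (use \<open>p \<noteq> q\<close> in auto)
  qed
  have F3_bounded: "topologically_bounded (strong_topology \<nu>) (strong_nbhd \<nu> p t)"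
    if t: "t > 0" and proper: "strong_nbhd \<nu> p t \<noteq> UNIV" for p t
  proof -
    \<comment> \<open>A point outside the neighbourhood bounds it: every member has a larger value
      of f, hence is strictly closer to p than q is.\<close>
    obtain q where "q \<notin> strong_nbhd \<nu> p t" using proper by blast
    then have "f (dist p q) \<le> 1 - t" by (simp add: nbhd[OF t] not_less)
    then have "dist p r < dist p q" if "1 - t < f (dist p r)" for r
      using anti[of "dist p q" "dist p r"] that by (cases "dist p r < dist p q") auto
    then have "strong_nbhd \<nu> p t \<subseteq> ball p (dist p q)"
      by (auto simp: nbhd[OF t])
    then show ?thesis
      unfolding top by (intro topologically_bounded_euclidean) (rule bounded_subset[OF bounded_ball])
  qed
  have "\<not> serstnev_space \<nu> (tau_sup T)"
  proof
    assume "serstnev_space \<nu> (tau_sup T)"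
    then have scale: "\<nu> (\<alpha> *\<^sub>R p\<^sub>0) (ereal x) = \<nu> p\<^sub>0 (ereal (x / \<bar>\<alpha>\<bar>))" if "\<alpha> \<noteq> 0" "x > 0" for \<alpha> x
      using that by (simp add: serstnev_space_def)
    \<comment> \<open>Near 0 the values of f exceed f at the norm of \<open>p\<^sub>0\<close>.
      Scaling \<open>p\<^sub>0\<close> to norm y/2 must therefore change f, whereas the Serstnev
      identity at x = 1 would preserve it, \<open>\<nu> p\<^sub>0\<close> being constant at positive
      reals.\<close>
    obtain y where y: "y > 0" "\<And>z. 0 < z \<Longrightarrow> z < y \<Longrightarrow> f (norm p\<^sub>0) < f z"
      using f_right[of 0 "f (norm p\<^sub>0)"] f0 f_less_1[OF p\<^sub>0] by auto
    define \<alpha> where "\<alpha> = y / (2 * norm p\<^sub>0)"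
    have \<alpha>: "norm (\<alpha> *\<^sub>R p\<^sub>0) = y / 2" "\<alpha> > 0" using y(1) p\<^sub>0 by (auto simp: \<alpha>_def)
    have "f (norm (\<alpha> *\<^sub>R p\<^sub>0)) = f (norm p\<^sub>0)"
      using scale[of \<alpha> 1] \<alpha>(2) by (simp add: \<nu>)
    with y(2)[of "y / 2"] y(1) show False by (simp only: \<alpha>(1)) simp
  qed
  moreover have "\<not> characteristic_pn \<nu>"
  proof
    assume "characteristic_pn \<nu>"
    \<comment> \<open>The function \<open>\<nu> p\<^sub>0\<close> would itself serve as the lower
      bound in \<open>D_plus\<close>.\<close>
    then have "D_bounded \<nu> {p\<^sub>0}" by (auto simp: characteristic_pn_def D_bounded_def)
    with not_D_bounded p\<^sub>0 show False by blast
  qed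
  ultimately show ?thesis
    using menger is_tvs_euclidean \<open>normable \<nu>\<close> F3_unbounded F3_bounded by (auto simp: top)
qed

end
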